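(* Let $\Delta t>0$, $u_h^0=\Pi u_0\in V_h$ and $U^0=\sqrt{F(u_0)+B}\in C^0(\Omega)$. For $n\ge 0$ consider the following scheme: given $u_h^n\in V_h$ and $U^n\in C^0(\Omega)$, find $(u_h^{n+1},w_h^{n+1})\in V_h\times V_h$ and $U^{n+1}\in C^0(\Omega)$ such that for all $\phi,\psi\in V_h$ $$\left(\frac{u_h^{n+1}-u_h^n}{\Delta t},\phi\right)=-A(M(u_h^n);w_h^{n+1},\phi),$$ $$(w_h^{n+1},\psi)=A(\epsilon^2;u_h^{n+1},\psi)+\left(H(u_h^n)U^{n+1},\psi\right),$$ $$U_h^n=\Pi U^n,\qquad \frac{U^{n+1}-U_h^n}{\Delta t}=\frac12 H(u_h^n)\frac{u_h^{n+1}-u_h^n}{\Delta t}\quad\text{(pointwise)}.$$ Then for any $\Delta t>0$ the scheme admits a unique solution $u_h^{n+1},w_h^{n+1}\in V_h$ and $U^{n+1}\in C^0(\Omega)$. The solution satisfies total mass conservation $\int_\Omega u_h^n\,dx=\int_\Omega u_h^0\,dx$ for any $n>0$. Additionally, with $U_h^{n+1}=\Pi U^{n+1}$, it satisfies, independently of the size of the time step $\Delta t$, the energy dissipation law $$E(u_h^{n+1},U_h^{n+1})\le E(u_h^{n+1},U^{n+1})=E(u_h^n,U_h^n)-\|U^{n+1}-U_h^n\|^2-\Delta t\,A(M(u_h^n);w_h^{n+1},w_h^{n+1})-\frac12A(\epsilon^2;u_h^{n+1}-u_h^n,u_h^{n+1}-u_h^n).$$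
   Context: $\Omega\subset\mathbb{R}^d$ ($d=2,3$) is a bounded domain and $\epsilon>0$ is a constant. $\mathcal T$ is a quasi-uniform triangulation $\Omega=\cup_{i=1}^N T_i$, and $V_h=\{v\in C^0(\Omega)\cap H^1(\Omega): v|_{T_i}\in P_k\ \forall T_i\in\mathcal T\}$, where $P_k$ is the space of polynomials of degree at most $k$ ($k\ge1$ fixed). $C^0(\Omega)$ denotes functions continuous on $\overline\Omega$. $(\cdot,\cdot)$ and $\|\cdot\|$ are the $L^2(\Omega)$ inner product and norm. $\Pi$ is the $L^2(\Omega)$-orthogonal projection onto $V_h$. For a coefficient $a(x)$, $A(a;q,v)=\int_\Omega a(x)\nabla q\cdot\nabla v\,dx$. The potential $F$ is a $C^1$ function on an interval $I\subseteq\mathbb{R}$ (e.g. $F(u)=\frac14(u^2-1)^2$ with $I=\mathbb{R}$, or the logarithmic Flory–Huggins potential with $I=(0,1)$). The constant $B\ge0$ is such that $F+B>0$, and $H(w)=F'(w)/\sqrt{F(w)+B}$. The mobility $M\ge0$ is a continuous function. It is a standing assumption that all functions at which $F,F',H,M$ are evaluated take values (on $\overline\Omega$) where these are defined and $F+B>0$. $u_0$ is the given initial datum. The energy is $E(v,V)=\frac12A(\epsilon^2;v,v)+\int_\Omega V^2\,dx-B|\Omega|$. *)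

theory Defs
  imports "HOL-Analysis.Analysis"
begin

section \<open>Integrals and \<open>L\<^sup>2\<close> structure on a domain\<close>

definition integ :: "'a::euclidean_space set \<Rightarrow> ('a \<Rightarrow> real) \<Rightarrow> real" where
  "integ \<Omega> f = integral\<^sup>L (lebesgue_on \<Omega>) f"

definition L2 :: "'a::euclidean_space set \<Rightarrow> ('a \<Rightarrow> 'b::euclidean_space) set" where
  "L2 \<Omega> = {f. f \<in> borel_measurable (lebesgue_on \<Omega>) \<and>
                integrable (lebesgue_on \<Omega>) (\<lambda>x. (norm (f x))\<^sup>2)}"

definition L2_inner :: "'a::euclidean_space set \<Rightarrow> ('a \<Rightarrow> real) \<Rightarrow> ('a \<Rightarrow> real) \<Rightarrow> real" where
  "L2_inner \<Omega> f g = integ \<Omega> (\<lambda>x. f x * g x)"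

definition L2_norm :: "'a::euclidean_space set \<Rightarrow> ('a \<Rightarrow> real) \<Rightarrow> real" where
  "L2_norm \<Omega> f = sqrt (L2_inner \<Omega> f f)"

text \<open>
  The orthogonal projection of \<open>f\<close> onto a subspace \<open>V\<close>. It is a genuine definite description
  whenever \<open>f\<close> is square integrable and \<open>V\<close> is a finite-dimensional space of functions that are
  determined by their values almost everywhere.
\<close>

definition L2_proj :: "'a::euclidean_space set \<Rightarrow> ('a \<Rightarrow> real) set \<Rightarrow> ('a \<Rightarrow> real) \<Rightarrow> ('a \<Rightarrow> real)" where
  "L2_proj \<Omega> V f = (THE p. p \<in> V \<and> (\<forall>\<phi>\<in>V. L2_inner \<Omega> (\<lambda>x. f x - p x) \<phi> = 0))"


section \<open>Continuous functions, weak gradients and \<open>H\<^sup>1\<close>\<close>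

text \<open>
  A function on the closure of \<open>\<Omega>\<close> is represented by its extension by zero to the whole space.
  Equality of functions on \<open>closure \<Omega>\<close> is thereby equality in HOL, and the representatives
  form a subspace.
\<close>

definition C0 :: "'a::euclidean_space set \<Rightarrow> ('a \<Rightarrow> real) set" where
  "C0 \<Omega> = {v. continuous_on (closure \<Omega>) v \<and> (\<forall>x. x \<notin> closure \<Omega> \<longrightarrow> v x = 0)}"

definition partial_deriv :: "'d::finite \<Rightarrow> (real^'d \<Rightarrow> real) \<Rightarrow> real^'d \<Rightarrow> real" where
  "partial_deriv i f x = frechet_derivative f (at x) (axis i 1)"

primrec Cm :: "nat \<Rightarrow> (real^'d::finite \<Rightarrow> real) \<Rightarrow> bool" where
  "Cm 0 f \<longleftrightarrow> continuous_on UNIV f"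
| "Cm (Suc m) f \<longleftrightarrow> (\<forall>x. f differentiable (at x)) \<and> (\<forall>i. Cm m (partial_deriv i f))"

definition test_functions :: "(real^'d::finite) set \<Rightarrow> (real^'d \<Rightarrow> real) set" where
  "test_functions \<Omega> =
     {\<phi>. (\<forall>m. Cm m \<phi>) \<and> compact (closure {x. \<phi> x \<noteq> 0}) \<and> closure {x. \<phi> x \<noteq> 0} \<subseteq> \<Omega>}"

definition is_weak_grad :: "(real^'d::finite) set \<Rightarrow> (real^'d \<Rightarrow> real) \<Rightarrow> (real^'d \<Rightarrow> real^'d) \<Rightarrow> bool" where
  "is_weak_grad \<Omega> v g \<longleftrightarrow>
     (\<forall>\<phi>\<in>test_functions \<Omega>. \<forall>i.
        integ \<Omega> (\<lambda>x. v x * partial_deriv i \<phi> x) = - integ \<Omega> (\<lambda>x. g x $ i * \<phi> x))"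

definition H1 :: "(real^'d::finite) set \<Rightarrow> (real^'d \<Rightarrow> real) set" where
  "H1 \<Omega> = {v. v \<in> L2 \<Omega> \<and> (\<exists>g\<in>L2 \<Omega>. is_weak_grad \<Omega> v g)}"

text \<open>Weak gradients are unique only up to null sets, hence the choice of a representative.\<close>

definition weak_grad :: "(real^'d::finite) set \<Rightarrow> (real^'d \<Rightarrow> real) \<Rightarrow> real^'d \<Rightarrow> real^'d" where
  "weak_grad \<Omega> v = (SOME g. g \<in> L2 \<Omega> \<and> is_weak_grad \<Omega> v g)"


section \<open>Triangulations and the finite element space\<close>

definition bounded_domain :: "'a::euclidean_space set \<Rightarrow> bool" where
  "bounded_domain \<Omega> \<longleftrightarrow> open \<Omega> \<and> connected \<Omega> \<and> \<Omega> \<noteq> {} \<and> bounded \<Omega>"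

text \<open>
  The library's \<^const>\<open>triangulation\<close> provides finiteness, simplices as elements, and
  conformity (two elements meet in a common face or not at all).
\<close>

definition triangulates :: "(real^'d::finite) set set \<Rightarrow> (real^'d) set \<Rightarrow> bool" where
  "triangulates \<T> \<Omega> \<longleftrightarrow>
     triangulation \<T> \<and> (\<forall>T\<in>\<T>. int CARD('d) simplex T) \<and> \<Union>\<T> = closure \<Omega>"

definition inradius :: "'a::euclidean_space set \<Rightarrow> real" where
  "inradius T = Sup {r. 0 \<le> r \<and> (\<exists>c. cball c r \<subseteq> T)}"

definition quasi_uniform :: "real \<Rightarrow> 'a::euclidean_space set set \<Rightarrow> bool" where
  "quasi_uniform \<sigma> \<T> \<longleftrightarrow> (\<forall>S\<in>\<T>. \<forall>T\<in>\<T>. diameter S \<le> \<sigma> * inradius T)"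

text \<open>
  Multi-indices are functions \<open>\<alpha>\<close> on the finite type of coordinates, so the outer sum
  ranges over a finite set.
\<close>

definition Pk :: "nat \<Rightarrow> (real^'d::finite \<Rightarrow> real) set" where
  "Pk k = {p. \<exists>c. \<forall>x. p x = (\<Sum>\<alpha>\<in>{\<alpha> :: 'd \<Rightarrow> nat. (\<Sum>i\<in>UNIV. \<alpha> i) \<le> k}.
                              c \<alpha> * (\<Prod>i\<in>UNIV. (x $ i) ^ \<alpha> i))}"

definition Vh :: "nat \<Rightarrow> (real^'d::finite) set set \<Rightarrow> (real^'d) set \<Rightarrow> (real^'d \<Rightarrow> real) set" where
  "Vh k \<T> \<Omega> = {v. v \<in> C0 \<Omega> \<and> v \<in> H1 \<Omega> \<and> (\<forall>T\<in>\<T>. \<exists>p\<in>Pk k. \<forall>x\<in>T. v x = p x)}"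


section \<open>The scheme\<close>

definition A_form :: "(real^'d::finite) set \<Rightarrow> (real^'d \<Rightarrow> real) \<Rightarrow> (real^'d \<Rightarrow> real) \<Rightarrow> (real^'d \<Rightarrow> real) \<Rightarrow> real" where
  "A_form \<Omega> a q v = integ \<Omega> (\<lambda>x. a x * (weak_grad \<Omega> q x \<bullet> weak_grad \<Omega> v x))"

definition energy :: "(real^'d::finite) set \<Rightarrow> real \<Rightarrow> real \<Rightarrow> (real^'d \<Rightarrow> real) \<Rightarrow> (real^'d \<Rightarrow> real) \<Rightarrow> real" where
  "energy \<Omega> \<epsilon> B v V =
     1/2 * A_form \<Omega> (\<lambda>x. \<epsilon>\<^sup>2) v v + integ \<Omega> (\<lambda>x. (V x)\<^sup>2) - B * measure lebesgue \<Omega>"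

definition Hfun :: "(real \<Rightarrow> real) \<Rightarrow> (real \<Rightarrow> real) \<Rightarrow> real \<Rightarrow> real \<Rightarrow> real" where
  "Hfun F F' B s = F' s / sqrt (F s + B)"

text \<open>
  One step of the scheme, with data \<open>(u, U)\<close> and result \<open>(u', w', U')\<close>; \<open>V\<close> is the finite
  element space and \<open>F'\<close> the derivative of \<open>F\<close>.
\<close>

definition scheme_step ::
  "(real^'d::finite) set \<Rightarrow> (real^'d \<Rightarrow> real) set \<Rightarrow> real \<Rightarrow> (real \<Rightarrow> real) \<Rightarrow> (real \<Rightarrow> real) \<Rightarrow> real \<Rightarrow>
   (real \<Rightarrow> real) \<Rightarrow> real \<Rightarrow> (real^'d \<Rightarrow> real) \<Rightarrow> (real^'d \<Rightarrow> real) \<Rightarrow>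
   (real^'d \<Rightarrow> real) \<Rightarrow> (real^'d \<Rightarrow> real) \<Rightarrow> (real^'d \<Rightarrow> real) \<Rightarrow> bool" where
  "scheme_step \<Omega> V \<epsilon> F F' B M dt u U u' w' U' \<longleftrightarrow>
     u' \<in> V \<and> w' \<in> V \<and> U' \<in> C0 \<Omega> \<and>
     (\<forall>\<phi>\<in>V. L2_inner \<Omega> (\<lambda>x. (u' x - u x) / dt) \<phi> = - A_form \<Omega> (\<lambda>x. M (u x)) w' \<phi>) \<and>
     (\<forall>\<psi>\<in>V. L2_inner \<Omega> w' \<psi> =
        A_form \<Omega> (\<lambda>x. \<epsilon>\<^sup>2) u' \<psi> + L2_inner \<Omega> (\<lambda>x. Hfun F F' B (u x) * U' x) \<psi>) \<and>
     (\<forall>x\<in>closure \<Omega>. (U' x - L2_proj \<Omega> V U x) / dt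
        = 1/2 * Hfun F F' B (u x) * ((u' x - u x) / dt))"

end

theory Submission
  imports Defs "HOL-Library.Function_Algebras" "HOL-Computational_Algebra.Polynomial"
begin

text \<open>
  Let \<open>V\<close> be the finite element space, \<open>v\<close> and \<open>Y\<close> the data of one step, and
  \<open>P\<close> the projection of \<open>Y\<close> onto \<open>V\<close>. The pointwise equation determines the new auxiliary variable
  on \<open>closure \<Omega>\<close> as \<open>P + H (u - v) / 2\<close>, and inserting this into the two variational equations
  leaves a linear system for \<open>u\<close> and \<open>w\<close> in \<open>V\<close>,
  \<open>(u, \<phi>) + dt m(w, \<phi>) = (v, \<phi>)\<close> and \<open>(w, \<psi>) = b(u, \<psi>) + (load, \<psi>)\<close>, in which
  \<open>m(w, \<phi>) = A(M(v); w, \<phi>)\<close> and \<open>b(u, \<psi>) = A(\<epsilon>\<^sup>2; u, \<psi>) + (H\<^sup>2 u, \<psi>) / 2\<close> are symmetric and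
  positive semidefinite.

  Uniqueness: for the homogeneous system, \<open>\<phi> = w\<close> and \<open>\<psi> = u\<close> give \<open>dt m(w, w) + b(u, u) = 0\<close>, so
  \<open>m(w, \<cdot>)\<close> and \<open>b(u, \<cdot>)\<close> vanish by the Cauchy-Schwarz inequality, and then so do \<open>u\<close> and \<open>w\<close>.
  Existence: the mobility may vanish, so the system is not coercive. Let \<open>S\<close> and \<open>K\<close> represent
  \<open>dt m\<close> and \<open>b\<close> with respect to the \<open>L\<^sup>2\<close> inner product. The system says that \<open>u + S K u\<close> is
  prescribed. The adjoint \<open>T = 1 + K S\<close> of \<open>1 + S K\<close> is injective by the argument just given, hence
  \<open>(T x, T y)\<close> is an inner product on \<open>V\<close>; solving a problem with this form by Lax-Milgram and
  putting \<open>u = T x\<close> solves the system (\<open>coupled_system_solvable\<close>, \<open>coupled_system_unique\<close>).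

  Mass is conserved because constants belong to \<open>V\<close> and have zero gradient. The energy identity
  follows from \<open>\<phi> = w\<close>, \<open>\<psi> = u - v\<close> and the pointwise equation, through
  \<open>a\<^sup>2 - b\<^sup>2 = 2 a (a - b) - (a - b)\<^sup>2\<close>, applied to the gradients and to the auxiliary variable; the
  inequality says that an orthogonal projection does not increase the norm.

  The analytic work is to see that \<open>A\<close> is a bilinear form at all. The weak gradient of a function is
  some function chosen among its weak gradients, so it depends linearly on the function only up to
  null sets, by the uniqueness of weak gradients (\<open>is_weak_grad_unique\<close>). That rests on the
  fundamental lemma of the calculus of variations, for which smooth functions with compact support
  are built from \<open>exp (- 1 / t)\<close>. That constants have zero weak gradient means that partial derivatives of
  test functions integrate to zero, which is a consequence of translation invariance.
\<close>

section \<open>Finite-dimensional linear algebra of forms on function spaces\<close>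

text \<open>
  With pointwise operations, functions form a real vector space, so that the general theory of subspaces,
  spans and independence applies to finite element spaces.
\<close>

instantiation "fun" :: (type, scaleR) scaleR
begin
definition "c *\<^sub>R f = (\<lambda>x. c *\<^sub>R f x)"
instance ..
end

lemma scaleR_fun_apply [simp]: "(c *\<^sub>R f) x = c *\<^sub>R f x"
  by (simp add: scaleR_fun_def)

instance "fun" :: (type, real_vector) real_vector
  by standard (simp_all add: fun_eq_iff algebra_simps)

text \<open>
  Linearity is relative to \<open>V\<close> because integrals of products are additive only on functions for which
  they exist.
\<close>

definition linear_form_on :: "'v::real_vector set \<Rightarrow> ('v \<Rightarrow> real) \<Rightarrow> bool" where
  "linear_form_on V l \<longleftrightarrow>
     (\<forall>x\<in>V. \<forall>y\<in>V. l (x + y) = l x + l y) \<and> (\<forall>c. \<forall>x\<in>V. l (c *\<^sub>R x) = c * l x)"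

definition bilinear_form_on :: "'v::real_vector set \<Rightarrow> ('v \<Rightarrow> 'v \<Rightarrow> real) \<Rightarrow> bool" where
  "bilinear_form_on V a \<longleftrightarrow>
     (\<forall>x\<in>V. linear_form_on V (a x)) \<and> (\<forall>y\<in>V. linear_form_on V (\<lambda>x. a x y))"

definition psd_form_on :: "'v::real_vector set \<Rightarrow> ('v \<Rightarrow> 'v \<Rightarrow> real) \<Rightarrow> bool" where
  "psd_form_on V a \<longleftrightarrow> bilinear_form_on V a \<and>
     (\<forall>x\<in>V. \<forall>y\<in>V. a x y = a y x) \<and> (\<forall>x\<in>V. 0 \<le> a x x)"

definition inner_product_on :: "'v::real_vector set \<Rightarrow> ('v \<Rightarrow> 'v \<Rightarrow> real) \<Rightarrow> bool" where
  "inner_product_on V a \<longleftrightarrow> psd_form_on V a \<and> (\<forall>x\<in>V. a x x = 0 \<longrightarrow> x = 0)"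

lemma psd_form_onD:
  assumes "psd_form_on V a"
  shows "bilinear_form_on V a" "\<And>x y. x \<in> V \<Longrightarrow> y \<in> V \<Longrightarrow> a x y = a y x" "\<And>x. x \<in> V \<Longrightarrow> 0 \<le> a x x"
  using assms unfolding psd_form_on_def by blast+

lemma inner_product_onD:
  assumes "inner_product_on V a"
  shows "psd_form_on V a" "\<And>x. x \<in> V \<Longrightarrow> a x x = 0 \<Longrightarrow> x = 0"
  using assms unfolding inner_product_on_def by blast+

lemma psd_form_onI:
  assumes "\<And>x. x \<in> V \<Longrightarrow> linear_form_on V (a x)" "\<And>x y. a x y = a y x" "\<And>x. 0 \<le> a x x"
  shows "psd_form_on V a"
proof -
  have "(\<lambda>x. a x y) = a y" for y by (rule ext) (rule assms(2))
  then show ?thesis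
    unfolding psd_form_on_def bilinear_form_on_def using assms by simp
qed

lemma linear_form_onD:
  assumes "linear_form_on V l"
  shows "x \<in> V \<Longrightarrow> y \<in> V \<Longrightarrow> l (x + y) = l x + l y"
    and "x \<in> V \<Longrightarrow> l (c *\<^sub>R x) = c * l x"
  using assms unfolding linear_form_on_def by auto

lemma linear_form_on_neg_diff:
  assumes l: "linear_form_on V l" and V: "subspace V"
  shows "x \<in> V \<Longrightarrow> l (- x) = - l x"
    and "x \<in> V \<Longrightarrow> y \<in> V \<Longrightarrow> l (x - y) = l x - l y"
    and "l 0 = 0"
proof -
  show neg: "l (- x) = - l x" if "x \<in> V" for x
    using linear_form_onD(2)[OF l that, of "- 1"] by simp
  show "l (x - y) = l x - l y" if "x \<in> V" "y \<in> V" for x y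
    using linear_form_onD(1)[OF l, of x "- y"] neg[of y] that subspace_neg[OF V] by simp
  show "l 0 = 0"
    using linear_form_onD(2)[OF l subspace_0[OF V], of 0] by simp
qed

lemma bilinear_form_on_left:
  assumes a: "bilinear_form_on V a" and V: "subspace V" and y: "y \<in> V"
  shows "x \<in> V \<Longrightarrow> x' \<in> V \<Longrightarrow> a (x + x') y = a x y + a x' y"
    and "x \<in> V \<Longrightarrow> a (c *\<^sub>R x) y = c * a x y"
    and "x \<in> V \<Longrightarrow> x' \<in> V \<Longrightarrow> a (x - x') y = a x y - a x' y"
    and "a 0 y = 0"
proof -
  have l: "linear_form_on V (\<lambda>x. a x y)" using a y unfolding bilinear_form_on_def by auto
  show "x \<in> V \<Longrightarrow> x' \<in> V \<Longrightarrow> a (x + x') y = a x y + a x' y"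
    "x \<in> V \<Longrightarrow> a (c *\<^sub>R x) y = c * a x y"
    "x \<in> V \<Longrightarrow> x' \<in> V \<Longrightarrow> a (x - x') y = a x y - a x' y" "a 0 y = 0"
    using linear_form_onD[OF l] linear_form_on_neg_diff[OF l V] by auto
qed

lemma bilinear_form_on_right:
  assumes a: "bilinear_form_on V a" and V: "subspace V" and y: "y \<in> V"
  shows "x \<in> V \<Longrightarrow> x' \<in> V \<Longrightarrow> a y (x + x') = a y x + a y x'"
    and "x \<in> V \<Longrightarrow> a y (c *\<^sub>R x) = c * a y x"
    and "x \<in> V \<Longrightarrow> x' \<in> V \<Longrightarrow> a y (x - x') = a y x - a y x'"
    and "a y 0 = 0"
proof -
  have l: "linear_form_on V (a y)" using a y unfolding bilinear_form_on_def by auto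
  show "x \<in> V \<Longrightarrow> x' \<in> V \<Longrightarrow> a y (x + x') = a y x + a y x'"
    "x \<in> V \<Longrightarrow> a y (c *\<^sub>R x) = c * a y x"
    "x \<in> V \<Longrightarrow> x' \<in> V \<Longrightarrow> a y (x - x') = a y x - a y x'" "a y 0 = 0"
    using linear_form_onD[OF l] linear_form_on_neg_diff[OF l V] by auto
qed

lemma bilinear_form_on_subset:
  assumes "bilinear_form_on V a" "W \<subseteq> V"
  shows "bilinear_form_on W a"
  using assms unfolding bilinear_form_on_def linear_form_on_def subset_iff by simp

text \<open>
  Induction on the generators by orthogonalisation, which replaces any argument with dimensions or
  matrices. If the problem is solvable on \<open>span B\<close>, subtract from a further generator \<open>g\<close> the \<open>r\<close> in
  \<open>span B\<close> with \<open>a(r, \<cdot>) = a(g, \<cdot>)\<close>. The remainder \<open>h\<close> satisfies \<open>a(h, \<cdot>) = 0\<close> on \<open>span B\<close>, so adding a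
  multiple of \<open>h\<close> to the solution on \<open>span B\<close> satisfies the one new equation and keeps the others.
\<close>

lemma lax_milgram_span:
  fixes B :: "'v::real_vector set"
  assumes "finite B" "bilinear_form_on (span B) a" "\<And>v. v \<in> span B \<Longrightarrow> v \<noteq> 0 \<Longrightarrow> 0 < a v v"
    and "linear_form_on (span B) l"
  shows "\<exists>u\<in>span B. \<forall>v\<in>span B. a u v = l v"
  using assms
proof (induction B arbitrary: l rule: finite_induct)
  case empty
  have "l 0 = 0" "a 0 0 = 0"
    using linear_form_on_neg_diff(3)[OF empty(3) subspace_span]
      bilinear_form_on_left(4)[OF empty(1) subspace_span span_zero] by auto
  then show ?case by simp
next
  case (insert g B)
  let ?W = "span B" and ?V = "span (insert g B)"
  have WV: "?W \<subseteq> ?V" by (simp add: span_mono subset_insertI)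
  have sV: "subspace ?V" and sW: "subspace ?W" by (rule subspace_span)+
  have bW: "bilinear_form_on ?W a" using bilinear_form_on_subset[OF insert.prems(1) WV] .
  have solveW: "\<exists>u\<in>?W. \<forall>v\<in>?W. a u v = l' v" if "linear_form_on ?W l'" for l'
    by (rule insert.IH[OF bW _ that]) (use insert.prems(2) WV in blast)
  have lW: "linear_form_on ?W l"
    using insert.prems(3) WV unfolding linear_form_on_def by blast
  note left = bilinear_form_on_left[OF insert.prems(1) sV] and right = bilinear_form_on_right[OF insert.prems(1) sV]
  have gV: "g \<in> ?V" by (simp add: span_base)
  have "linear_form_on ?W (a g)"
    using insert.prems(1) gV WV unfolding bilinear_form_on_def linear_form_on_def by blast
  then obtain r where r: "r \<in> ?W" "\<And>v. v \<in> ?W \<Longrightarrow> a r v = a g v" using solveW by blast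
  obtain u0 where u0: "u0 \<in> ?W" "\<And>v. v \<in> ?W \<Longrightarrow> a u0 v = l v" using solveW[OF lW] by blast
  define h where "h = g - r"
  have hV: "h \<in> ?V" unfolding h_def using gV r(1) WV by (blast intro: span_diff)
  have hW: "a h v = 0" if "v \<in> ?W" for v
    unfolding h_def using left(3)[of v g r] that r gV WV by auto
  have decomp: "\<exists>c. \<exists>w\<in>?W. v = w + c *\<^sub>R h" if v: "v \<in> ?V" for v
  proof -
    obtain c where c: "v - c *\<^sub>R g \<in> ?W" using v by (metis insertI1 span_breakdown_eq)
    have "v = ((v - c *\<^sub>R g) + c *\<^sub>R r) + c *\<^sub>R h"
      by (simp add: h_def algebra_simps)
    moreover have "(v - c *\<^sub>R g) + c *\<^sub>R r \<in> ?W" using c r(1) by (blast intro: span_add span_scale)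
    ultimately show ?thesis by blast
  qed
  \<comment> \<open>If \<open>g\<close> already lies in the span of \<open>B\<close>, then \<open>h = 0\<close> and there is no new equation.\<close>
  define c where "c = (if h = 0 then 0 else (l h - a u0 h) / a h h)"
  have c: "a u0 h + c * a h h = l h"
  proof (cases "h = 0")
    case True
    then show ?thesis
      using u0(2)[of 0] u0(1) WV right(4) by (auto simp: span_zero c_def)
  next
    case False
    then have "a h h > 0" using insert.prems(2)[OF hV] by simp
    then show ?thesis using False by (simp add: c_def)
  qed
  show ?case
  proof (intro bexI ballI)
    fix v assume "v \<in> ?V"
    then obtain d w where w: "w \<in> ?W" and v: "v = w + d *\<^sub>R h" using decomp by blast
    have V: "w \<in> ?V" "u0 \<in> ?V" "c *\<^sub>R h \<in> ?V" "d *\<^sub>R h \<in> ?V" using w u0 hV WV by (auto simp: span_scale)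
    have "a (u0 + c *\<^sub>R h) v = l w + d * (a u0 h + c * a h h)"
      using V hV w u0 hW unfolding v
      by (simp add: left right subspace_add[OF sV] subspace_scale[OF sV] distrib_left mult.left_commute)
    also have "\<dots> = l v"
      unfolding v c using V hV by (simp add: linear_form_onD[OF insert.prems(3)])
    finally show "a (u0 + c *\<^sub>R h) v = l v" .
  qed (use u0(1) hV WV in \<open>auto intro: span_add span_scale\<close>)
qed

lemma lax_milgram_finite_dim:
  fixes V :: "'v::real_vector set"
  assumes V: "subspace V" "finite G" "V \<subseteq> span G"
    and a: "bilinear_form_on V a" "\<And>v. v \<in> V \<Longrightarrow> v \<noteq> 0 \<Longrightarrow> 0 < a v v"
    and l: "linear_form_on V l"
  shows "\<exists>u\<in>V. \<forall>v\<in>V. a u v = l v"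
proof -
  obtain B where B: "B \<subseteq> V" "independent B" "V \<subseteq> span B"
    using maximal_independent_subset by blast
  have fin: "finite B" using independent_span_bound[OF V(2) B(2)] B(1) V(3) by blast
  have "V = span B" using B V(1) by (metis span_minimal subset_antisym)
  then show ?thesis using lax_milgram_span[OF fin, of a l] a l by simp
qed

text \<open>
  The equality case of the Cauchy-Schwarz inequality: otherwise \<open>a(t x + y, t x + y)\<close> would be
  affine and nonconstant in \<open>t\<close>, hence negative somewhere.
\<close>

lemma psd_form_on_null:
  assumes a: "psd_form_on V a" and V: "subspace V" and x: "x \<in> V" and null: "a x x = 0" and y: "y \<in> V"
  shows "a x y = 0"
proof (rule ccontr)
  assume ne: "a x y \<noteq> 0"
  have bil: "bilinear_form_on V a" and sym: "a y x = a x y" and pos: "\<And>z. z \<in> V \<Longrightarrow> 0 \<le> a z z"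
    by (rule psd_form_onD[OF a] x y; assumption?)+
  \<comment> \<open>The value of \<open>t\<close> at which the affine function \<open>a(t x + y, t x + y)\<close> equals \<open>-1\<close>.\<close>
  define t where "t = - (a y y + 1) / (2 * a x y)"
  have tx: "t *\<^sub>R x \<in> V" using V x by (simp add: subspace_scale)
  have "a (t *\<^sub>R x + y) (t *\<^sub>R x + y) = 2 * t * a x y + a y y"
    using x y tx null sym
    by (simp add: bilinear_form_on_left[OF bil V] bilinear_form_on_right[OF bil V] subspace_add[OF V])
  also have "\<dots> = -1" using ne by (simp add: t_def field_simps)
  finally show False using pos[OF subspace_add[OF V tx y]] by simp
qed

text \<open>
  Elements of \<open>V\<close> are compared by testing: this gives the linearity of representing operators, and the
  uniqueness of the projection.
\<close>

lemma inner_product_on_eqI: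
  assumes ip: "inner_product_on V ip" and V: "subspace V" and xy: "x \<in> V" "y \<in> V"
    and eq: "\<And>v. v \<in> V \<Longrightarrow> ip x v = ip y v"
  shows "x = y"
proof -
  have "bilinear_form_on V ip" by (rule psd_form_onD(1)[OF inner_product_onD(1)[OF ip]])
  then have "ip (x - y) (x - y) = 0"
    using bilinear_form_on_left(3)[of V ip "x - y" x y] V xy eq by (simp add: subspace_diff)
  then have "x - y = 0"
    by (rule inner_product_onD(2)[OF ip subspace_diff[OF V xy]])
  then show ?thesis by simp
qed

lemma finite_dim_riesz:
  assumes V: "subspace V" "finite G" "V \<subseteq> span G" and ip: "inner_product_on V ip"
    and l: "linear_form_on V l"
  shows "\<exists>r\<in>V. \<forall>v\<in>V. ip r v = l v"
proof (rule lax_milgram_finite_dim[OF V])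
  show "bilinear_form_on V ip" by (rule psd_form_onD(1)[OF inner_product_onD(1)[OF ip]])
  show "0 < ip v v" if "v \<in> V" "v \<noteq> 0" for v
    using psd_form_onD(3)[OF inner_product_onD(1)[OF ip] that(1)] inner_product_onD(2)[OF ip that(1)] that(2)
    by fastforce
qed (rule l)

text \<open>
  Bilinearity of \<open>a\<close> becomes linearity of \<open>S\<close> because the inner product separates points.
\<close>

lemma representing_operator:
  assumes V: "subspace V" "finite G" "V \<subseteq> span G" and ip: "inner_product_on V ip"
    and a: "bilinear_form_on V a"
  obtains S where "\<And>v. v \<in> V \<Longrightarrow> S v \<in> V" "\<And>v w. v \<in> V \<Longrightarrow> w \<in> V \<Longrightarrow> ip (S v) w = a v w"
    "\<And>v w. v \<in> V \<Longrightarrow> w \<in> V \<Longrightarrow> S (v + w) = S v + S w" "\<And>c v. v \<in> V \<Longrightarrow> S (c *\<^sub>R v) = c *\<^sub>R S v"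
proof -
  have "\<exists>r\<in>V. \<forall>w\<in>V. ip r w = a v w" if "v \<in> V" for v
    by (rule finite_dim_riesz[OF V ip]) (use a that in \<open>simp add: bilinear_form_on_def\<close>)
  then have "\<forall>v\<in>V. \<exists>r. r \<in> V \<and> (\<forall>w\<in>V. ip r w = a v w)" by blast
  from bchoice[OF this] obtain S where SV: "\<And>v. v \<in> V \<Longrightarrow> S v \<in> V"
    and S: "\<And>v w. v \<in> V \<Longrightarrow> w \<in> V \<Longrightarrow> ip (S v) w = a v w" by auto
  have bil: "bilinear_form_on V ip" by (rule psd_form_onD(1)[OF inner_product_onD(1)[OF ip]])
  note rules = bilinear_form_on_left[OF bil V(1)] bilinear_form_on_left[OF a V(1)]
    subspace_add[OF V(1)] subspace_scale[OF V(1)] SV S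
  show ?thesis
  proof
    show "S (v + w) = S v + S w" if "v \<in> V" "w \<in> V" for v w
      by (rule inner_product_on_eqI[OF ip V(1)]) (use that in \<open>simp_all add: rules\<close>)
    show "S (c *\<^sub>R v) = c *\<^sub>R S v" if "v \<in> V" for v c
      by (rule inner_product_on_eqI[OF ip V(1)]) (use that in \<open>simp_all add: rules\<close>)
  qed (use SV S in auto)
qed

text \<open>
  With \<open>S\<close>, \<open>K\<close>, \<open>r\<close> representing \<open>m\<close>, \<open>b\<close>, \<open>g\<close>, the second equation is \<open>w = K u + r\<close>. Moving \<open>S\<close> and \<open>K\<close>
  to the test function turns the first into \<open>(u, \<phi> + K (S \<phi>)) = f \<phi> - m(r, \<phi>)\<close>. The ansatz \<open>u = T v\<close> with
  \<open>T = 1 + K S\<close> makes the left side \<open>(T v, T \<phi>)\<close>, which is positive definite since \<open>T\<close> is injective.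
\<close>

lemma coupled_system_solvable:
  assumes V: "subspace V" "finite G" "V \<subseteq> span G" and ip: "inner_product_on V ip"
    and m: "psd_form_on V m" and b: "psd_form_on V b"
    and f: "linear_form_on V f" and g: "linear_form_on V g"
  obtains u w where "u \<in> V" "w \<in> V" "\<And>\<phi>. \<phi> \<in> V \<Longrightarrow> ip u \<phi> + m w \<phi> = f \<phi>"
    "\<And>\<psi>. \<psi> \<in> V \<Longrightarrow> ip w \<psi> = b u \<psi> + g \<psi>"
proof -
  have bil: "bilinear_form_on V ip" "bilinear_form_on V m" "bilinear_form_on V b"
    and sym: "\<And>x y. x \<in> V \<Longrightarrow> y \<in> V \<Longrightarrow> ip x y = ip y x"
      "\<And>x y. x \<in> V \<Longrightarrow> y \<in> V \<Longrightarrow> m x y = m y x"  "\<And>x y. x \<in> V \<Longrightarrow> y \<in> V \<Longrightarrow> b x y = b y x"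
    and pos: "\<And>x. x \<in> V \<Longrightarrow> 0 \<le> m x x" "\<And>x. x \<in> V \<Longrightarrow> 0 \<le> b x x" "\<And>x. x \<in> V \<Longrightarrow> 0 \<le> ip x x"
    and pd: "\<And>x. x \<in> V \<Longrightarrow> ip x x = 0 \<Longrightarrow> x = 0"
    by (rule psd_form_onD[OF inner_product_onD(1)[OF ip]] psd_form_onD[OF m] psd_form_onD[OF b]
        inner_product_onD(2)[OF ip]; assumption)+
  obtain S where S: "\<And>v. v \<in> V \<Longrightarrow> S v \<in> V" "\<And>v w. v \<in> V \<Longrightarrow> w \<in> V \<Longrightarrow> ip (S v) w = m v w"
    "\<And>v w. v \<in> V \<Longrightarrow> w \<in> V \<Longrightarrow> S (v + w) = S v + S w" "\<And>c v. v \<in> V \<Longrightarrow> S (c *\<^sub>R v) = c *\<^sub>R S v"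
    by (rule representing_operator[OF V ip bil(2)]) blast
  obtain K where K: "\<And>v. v \<in> V \<Longrightarrow> K v \<in> V" "\<And>v w. v \<in> V \<Longrightarrow> w \<in> V \<Longrightarrow> ip (K v) w = b v w"
    "\<And>v w. v \<in> V \<Longrightarrow> w \<in> V \<Longrightarrow> K (v + w) = K v + K w" "\<And>c v. v \<in> V \<Longrightarrow> K (c *\<^sub>R v) = c *\<^sub>R K v"
    by (rule representing_operator[OF V ip bil(3)]) blast
  obtain r where r: "r \<in> V" "\<And>v. v \<in> V \<Longrightarrow> ip r v = g v"
    using finite_dim_riesz[OF V ip g] by blast
  define T where "T v = v + K (S v)" for v
  have TV: "T v \<in> V" if "v \<in> V" for v unfolding T_def using that S K V(1) by (simp add: subspace_add)
  note left = bilinear_form_on_left[OF bil(1) V(1)] bilinear_form_on_left[OF bil(2) V(1)] bilinear_form_on_left[OF bil(3) V(1)]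
  note right = bilinear_form_on_right[OF bil(1) V(1)] bilinear_form_on_right[OF bil(2) V(1)] bilinear_form_on_right[OF bil(3) V(1)]
  have Tadd: "T (v + w) = T v + T w" if "v \<in> V" "w \<in> V" for v w
    unfolding T_def using that S K by simp
  have Tscale: "T (c *\<^sub>R v) = c *\<^sub>R T v" if "v \<in> V" for c v
    unfolding T_def using that S K by (simp add: scaleR_add_right)
  have Tinj: "v = 0" if v: "v \<in> V" and T0: "T v = 0" for v
  proof -
    \<comment> \<open>Testing \<open>T v = 0\<close> with \<open>S v\<close> splits into two nonnegative terms.\<close>
    have "0 = ip (T v) (S v)" using T0 left(4) S(1)[OF v] by simp
    also have "\<dots> = m v v + b (S v) (S v)"
      unfolding T_def using v S K sym(1) by (simp add: left)
    finally have "m v v = 0" using pos(1)[OF v] pos(2)[OF S(1)[OF v]] by linarith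
    then have "ip (S v) (S v) = 0"
      using psd_form_on_null[OF m V(1) v] S v by simp
    then have "S v = 0" using pd S(1)[OF v] by blast
    moreover have "K 0 = 0" using K(4)[OF v, of 0] by simp
    ultimately show ?thesis using T0 unfolding T_def by simp
  qed
  have "\<exists>v\<in>V. \<forall>\<phi>\<in>V. ip (T v) (T \<phi>) = f \<phi> - m r \<phi>"
  proof (rule lax_milgram_finite_dim[OF V, of "\<lambda>v \<phi>. ip (T v) (T \<phi>)" "\<lambda>\<phi>. f \<phi> - m r \<phi>"])
    show "bilinear_form_on V (\<lambda>v \<phi>. ip (T v) (T \<phi>))"
      unfolding bilinear_form_on_def linear_form_on_def
      by (auto simp: Tadd Tscale TV left right)
    show "0 < ip (T v) (T v)" if "v \<in> V" "v \<noteq> 0" for v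
      using pos(3)[OF TV[OF that(1)]] Tinj[OF that(1)] pd[OF TV[OF that(1)]] that(2) by (metis order_le_less)
    show "linear_form_on V (\<lambda>\<phi>. f \<phi> - m r \<phi>)"
      using linear_form_onD[OF f] r(1) unfolding linear_form_on_def by (auto simp: right algebra_simps)
  qed
  then obtain v where v: "v \<in> V" "\<And>\<phi>. \<phi> \<in> V \<Longrightarrow> ip (T v) (T \<phi>) = f \<phi> - m r \<phi>" by blast
  show ?thesis
  proof
    show uV: "T v \<in> V" using TV v by blast
    show "K (T v) + r \<in> V" using K(1)[OF uV] r V(1) by (simp add: subspace_add)
    show "ip (T v) \<phi> + m (K (T v) + r) \<phi> = f \<phi>" if p: "\<phi> \<in> V" for \<phi>
    proof -
      have "m (K (T v)) \<phi> = ip (K (T v)) (S \<phi>)"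
        using S p K uV sym by metis
      also have "\<dots> = ip (T v) (K (S \<phi>))"
        using S p K uV sym by metis
      finally have "ip (T v) \<phi> + m (K (T v)) \<phi> = ip (T v) (T \<phi>)"
        unfolding T_def[of \<phi>] using p S K uV by (simp add: right)
      then show ?thesis using v(2)[OF p] p K(1)[OF uV] r(1) by (simp add: left)
    qed
    show "ip (K (T v) + r) \<psi> = b (T v) \<psi> + g \<psi>" if "\<psi> \<in> V" for \<psi>
      using that K uV r by (simp add: left)
  qed
qed

text \<open>
  The two coupling terms \<open>(u, w)\<close> cancel when the equations for the difference of two solutions are
  tested with each other's unknown.
\<close>

lemma coupled_system_unique:
  assumes V: "subspace V" and ip: "inner_product_on V ip"
    and m: "psd_form_on V m" and b: "psd_form_on V b"
    and uw: "u \<in> V" "w \<in> V" and uw': "u' \<in> V" "w' \<in> V"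
    and eq: "\<And>\<phi>. \<phi> \<in> V \<Longrightarrow> ip u \<phi> + m w \<phi> = f \<phi>" "\<And>\<psi>. \<psi> \<in> V \<Longrightarrow> ip w \<psi> = b u \<psi> + g \<psi>"
    and eq': "\<And>\<phi>. \<phi> \<in> V \<Longrightarrow> ip u' \<phi> + m w' \<phi> = f \<phi>" "\<And>\<psi>. \<psi> \<in> V \<Longrightarrow> ip w' \<psi> = b u' \<psi> + g \<psi>"
  shows "u = u' \<and> w = w'"
proof -
  have bil: "bilinear_form_on V ip" "bilinear_form_on V m" "bilinear_form_on V b"
    and sym: "\<And>x y. x \<in> V \<Longrightarrow> y \<in> V \<Longrightarrow> ip x y = ip y x"
    and pos: "\<And>x. x \<in> V \<Longrightarrow> 0 \<le> m x x" "\<And>x. x \<in> V \<Longrightarrow> 0 \<le> b x x"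
    by (rule psd_form_onD[OF inner_product_onD(1)[OF ip]] psd_form_onD[OF m] psd_form_onD[OF b]; assumption)+
  note left = bilinear_form_on_left[OF bil(1) V] bilinear_form_on_left[OF bil(2) V] bilinear_form_on_left[OF bil(3) V]
  define d e where "d = u - u'" and "e = w - w'"
  have de: "d \<in> V" "e \<in> V" unfolding d_def e_def using uw uw' V by (auto simp: subspace_diff)
  have 1: "ip d \<phi> + m e \<phi> = 0" if "\<phi> \<in> V" for \<phi>
    unfolding d_def e_def left(3)[OF that uw(1) uw'(1)] left(7)[OF that uw(2) uw'(2)]
    using eq(1)[OF that] eq'(1)[OF that] by linarith
  have 2: "ip e \<psi> = b d \<psi>" if "\<psi> \<in> V" for \<psi>
    unfolding d_def e_def left(3)[OF that uw(2) uw'(2)] left(11)[OF that uw(1) uw'(1)]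
    using eq(2)[OF that] eq'(2)[OF that] by linarith
  \<comment> \<open>The two terms \<open>(d, e)\<close> cancel.\<close>
  have "m e e + b d d = 0"
    using 1[OF de(2)] 2[OF de(1)] sym[OF de] by linarith
  then have "m e e = 0" "b d d = 0" using pos(1)[OF de(2)] pos(2)[OF de(1)] by linarith+
  then have "m e \<phi> = 0" "b d \<phi> = 0" if "\<phi> \<in> V" for \<phi>
    using psd_form_on_null[OF m V de(2)] psd_form_on_null[OF b V de(1)] that by auto
  then have "ip d d = 0" "ip e e = 0" using 1[OF de(1)] 2[OF de(2)] de by auto
  then have "d = 0" "e = 0" using inner_product_onD(2)[OF ip] de by blast+
  then show ?thesis unfolding d_def e_def by simp
qed

section \<open>Smooth functions with compact support\<close>

text \<open>
  The function \<open>p(1/t) exp(-1/t)\<close> on the positive axis, extended by zero; \<open>flat 1\<close> is the standard smooth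
  function that is flat at the origin. Carrying the polynomial \<open>p\<close> makes the family closed under
  derivatives.
\<close>

definition flat :: "real poly \<Rightarrow> real \<Rightarrow> real" where
  "flat p t = (if 0 < t then poly p (inverse t) * exp (- inverse t) else 0)"

lemma poly_over_exp_tendsto_0:
  "((\<lambda>s. poly p s * exp (- s)) \<longlongrightarrow> 0) at_top" for p :: "real poly"
proof -
  have "((\<lambda>s. \<Sum>i\<le>degree p. coeff p i * (s ^ i / exp s)) \<longlongrightarrow> (\<Sum>i\<le>degree p. coeff p i * 0)) at_top"
    by (intro tendsto_sum tendsto_mult tendsto_const tendsto_power_div_exp_0)
  then show ?thesis
    by (simp add: poly_altdef sum_distrib_right exp_minus divide_inverse mult.assoc)
qed

text \<open>
  The factor \<open>[:0, 0, 1:]\<close> is \<open>1 / t\<^sup>2\<close> from the inner derivative. The family \<open>flat p\<close> is closed under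
  differentiation, and this is what makes each of its members smooth.
\<close>

lemma flat_has_derivative:
  "(flat p has_real_derivative flat ([:0, 0, 1:] * (p - pderiv p)) t) (at t)"
proof -
  consider "t > 0" | "t < 0" | "t = 0" by linarith
  then show ?thesis
  proof cases
    case 1
    have inv: "(inverse has_real_derivative - (inverse t * inverse t)) (at t)"
      using DERIV_inverse[of t] 1 by (simp add: numeral_2_eq_2)
    have "poly (pderiv p) (inverse t) * - (inverse t * inverse t) * exp (- inverse t)
            + exp (- inverse t) * - (- (inverse t * inverse t)) * poly p (inverse t)
          = flat ([:0, 0, 1:] * (p - pderiv p)) t"
      using 1 by (simp add: flat_def algebra_simps)
    then have "((\<lambda>t. poly p (inverse t) * exp (- inverse t)) has_real_derivative
             flat ([:0, 0, 1:] * (p - pderiv p)) t) (at t)"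
      using DERIV_mult[OF DERIV_chain2[OF poly_DERIV inv] DERIV_chain2[OF DERIV_exp DERIV_minus[OF inv]]]
      by (rule DERIV_cong[rotated])
    moreover have "\<forall>\<^sub>F s in nhds t. s \<in> {0<..}"
      using 1 by (intro eventually_nhds_in_open) auto
    then have ev: "\<forall>\<^sub>F s in nhds t. flat p s = poly p (inverse s) * exp (- inverse s)"
      by (rule eventually_mono) (simp add: flat_def)
    ultimately show ?thesis by (subst DERIV_cong_ev[OF refl ev refl])
  next
    case 2
    have "\<forall>\<^sub>F s in nhds t. s \<in> {..<0}"
      using 2 by (intro eventually_nhds_in_open) auto
    then have ev: "\<forall>\<^sub>F s in nhds t. flat p s = 0"
      by (rule eventually_mono) (simp add: flat_def)
    have "flat ([:0, 0, 1:] * (p - pderiv p)) t = 0" using 2 by (simp only: flat_def) simp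
    then show ?thesis by (subst DERIV_cong_ev[OF refl ev refl]) (simp only: DERIV_const)
  next
    case 3
    have "((\<lambda>h. poly ([:0, 1:] * p) (inverse h) * exp (- inverse h)) \<longlongrightarrow> 0) (at_right 0)"
      by (rule filterlim_compose[OF poly_over_exp_tendsto_0 filterlim_inverse_at_top_right])
    moreover have "\<forall>\<^sub>F h in at_right 0. poly ([:0, 1:] * p) (inverse h) * exp (- inverse h) = (flat p h - flat p 0) / (h - 0)"
      by (rule eventually_at_rightI[of 0 1]) (simp_all add: flat_def divide_inverse)
    ultimately have R: "((\<lambda>h. (flat p h - flat p 0) / (h - 0)) \<longlongrightarrow> 0) (at_right 0)"
      by (rule Lim_transform_eventually)
    have "\<forall>\<^sub>F h in at_left 0. (flat p h - flat p 0) / (h - 0) = 0"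
      by (rule eventually_at_leftI[of "-1" 0]) (simp_all add: flat_def)
    then have L: "((\<lambda>h. (flat p h - flat p 0) / (h - 0)) \<longlongrightarrow> 0) (at_left 0)"
      by (rule tendsto_eventually)
    show ?thesis
      unfolding 3 has_field_derivative_iff filterlim_at_split using L R by (simp add: flat_def)
  qed
qed

lemma flat_eq_0_iff: "flat 1 t = 0 \<longleftrightarrow> t \<le> 0"
  by (auto simp: flat_def)

lemma flat_bounds: "0 \<le> flat 1 t" "flat 1 t \<le> 1"
  by (simp_all add: flat_def)

lemma flat_tendsto_1: "(flat 1 \<longlongrightarrow> 1) at_top"
proof -
  have "((\<lambda>t::real. exp (- inverse t)) \<longlongrightarrow> exp (- 0)) at_top"
    by (intro tendsto_intros tendsto_inverse_0_at_top filterlim_ident)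
  moreover have "\<forall>\<^sub>F t::real in at_top. exp (- inverse t) = flat 1 t"
    using eventually_gt_at_top[of 0] by (auto elim!: eventually_mono simp: flat_def)
  ultimately show ?thesis using Lim_transform_eventually by fastforce
qed

lemma partial_deriv_eqI:
  assumes "(f has_derivative f') (at x)"
  shows "partial_deriv i f x = f' (axis i 1)"
  unfolding partial_deriv_def frechet_derivative_at[OF assms, symmetric] ..

lemma Cm_SucI:
  assumes "\<And>x. (f has_derivative f' x) (at x)" "\<And>i. Cm m (\<lambda>x. f' x (axis i 1))"
  shows "Cm (Suc m) f"
proof -
  have "partial_deriv i f = (\<lambda>x. f' x (axis i 1))" for i
    using partial_deriv_eqI[OF assms(1)] by blast
  then show ?thesis using assms by (auto simp: differentiable_def)
qed

lemma Cm_SucE: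
  assumes "Cm (Suc m) f"
  shows "(f has_derivative frechet_derivative f (at x)) (at x)" "Cm m (\<lambda>x. frechet_derivative f (at x) (axis i 1))"
  using assms by (auto simp: frechet_derivative_works partial_deriv_def[abs_def])

lemma Cm_Suc_imp_Cm: "Cm (Suc m) f \<Longrightarrow> Cm m f"
proof (induction m arbitrary: f)
  case 0
  then show ?case
    by (auto intro!: differentiable_imp_continuous_on simp: differentiable_on_def differentiable_at_withinI)
next
  case (Suc m)
  then show ?case by (metis Cm.simps(2))
qed

lemma Cm_continuous: "Cm m f \<Longrightarrow> continuous_on UNIV f"
proof (induction m)
  case (Suc m)
  then show ?case using Cm_Suc_imp_Cm by blast
qed simp

lemma Cm_const: "Cm m (\<lambda>_. c)"
proof (induction m arbitrary: c)
  case (Suc m)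
  show ?case by (rule Cm_SucI[where f' = "\<lambda>_ _. 0"]) (use Suc in auto)
qed auto

lemma Cm_nth: "Cm m (\<lambda>x. x $ j)"
proof (cases m)
  case (Suc n)
  have "Cm (Suc n) (\<lambda>x. x $ j)"
    by (rule Cm_SucI[where f' = "\<lambda>_ h. h $ j"])
       (auto intro!: Cm_const bounded_linear_imp_has_derivative bounded_linear_vec_nth)
  then show ?thesis using Suc by simp
qed (auto intro!: continuous_intros)

lemma Cm_add: "Cm m f \<Longrightarrow> Cm m g \<Longrightarrow> Cm m (\<lambda>x. f x + g x)"
proof (induction m arbitrary: f g)
  case (Suc m)
  show ?case
    by (rule Cm_SucI, rule has_derivative_add[OF Cm_SucE(1)[OF Suc.prems(1)] Cm_SucE(1)[OF Suc.prems(2)]])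
       (intro Suc.IH Cm_SucE(2)[OF Suc.prems(1)] Cm_SucE(2)[OF Suc.prems(2)])
qed (auto intro: continuous_intros)

lemma Cm_mult: "Cm m f \<Longrightarrow> Cm m g \<Longrightarrow> Cm m (\<lambda>x. f x * g x)"
proof (induction m arbitrary: f g)
  case (Suc m)
  show ?case
    by (rule Cm_SucI, rule has_derivative_mult[OF Cm_SucE(1)[OF Suc.prems(1)] Cm_SucE(1)[OF Suc.prems(2)]])
       (intro Cm_add Suc.IH Cm_SucE(2)[OF Suc.prems(1)] Cm_SucE(2)[OF Suc.prems(2)]
          Cm_Suc_imp_Cm[OF Suc.prems(1)] Cm_Suc_imp_Cm[OF Suc.prems(2)])
qed (auto intro: continuous_intros)

lemma Cm_sum: "(\<And>i. i \<in> A \<Longrightarrow> Cm m (f i)) \<Longrightarrow> Cm m (\<lambda>x. \<Sum>i\<in>A. f i x)"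
  by (induction A rule: infinite_finite_induct) (auto intro: Cm_const Cm_add)

lemma Cm_prod: "(\<And>i. i \<in> A \<Longrightarrow> Cm m (f i)) \<Longrightarrow> Cm m (\<lambda>x. \<Prod>i\<in>A. f i x)"
  by (induction A rule: infinite_finite_induct) (auto intro: Cm_const Cm_mult)

text \<open>
  The chain rule leads from \<open>flat p\<close> to \<open>flat q\<close> with another polynomial \<open>q\<close>, so the induction has to be
  over all polynomials at once.
\<close>

lemma Cm_flat: "Cm m f \<Longrightarrow> Cm m (\<lambda>x. flat p (f x))"
proof (induction m arbitrary: f p)
  case 0
  have "continuous_on UNIV (flat p)"
    by (meson DERIV_isCont continuous_at_imp_continuous_on flat_has_derivative)
  from continuous_on_compose2[OF this, of UNIV f] 0 show ?case by simp
next
  case (Suc m)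
  define q where "q = [:0, 0, 1:] * (p - pderiv p)"
  have "(flat p has_derivative (\<lambda>h. h * flat q t)) (at t)" for t
    by (rule has_derivative_eq_rhs[OF flat_has_derivative[unfolded has_field_derivative_def]])
       (unfold q_def, rule ext, rule mult.commute)
  then have der: "((\<lambda>x. flat p (f x)) has_derivative
      (\<lambda>h. frechet_derivative f (at x) h * flat q (f x))) (at x)" for x
    by (rule has_derivative_compose[OF Cm_SucE(1)[OF Suc.prems]])
  have IH: "Cm m (\<lambda>x. flat q (f x))"
    using Suc.IH Cm_Suc_imp_Cm[OF Suc.prems] by blast
  have "Cm m (\<lambda>x. frechet_derivative f (at x) (axis i 1) * flat q (f x))" for i
    by (rule Cm_mult) (fact Cm_SucE(2)[OF Suc.prems], fact IH)
  then show ?case using Cm_SucI[OF der] by blast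
qed

definition box_bump :: "real^'d::finite \<Rightarrow> real^'d \<Rightarrow> real^'d \<Rightarrow> real" where
  "box_bump a b x = (\<Prod>i\<in>UNIV. flat 1 (x $ i - a $ i) * flat 1 (b $ i - x $ i))"

lemma box_bump_nonneg: "0 \<le> box_bump a b x"
  unfolding box_bump_def by (intro prod_nonneg ballI mult_nonneg_nonneg flat_bounds)

lemma box_bump_pos_iff: "0 < box_bump a b x \<longleftrightarrow> x \<in> box a b"
proof -
  have "0 < box_bump a b x \<longleftrightarrow> box_bump a b x \<noteq> 0"
    using box_bump_nonneg[of a b x] by linarith
  also have "\<dots> \<longleftrightarrow> (\<forall>i. flat 1 (x $ i - a $ i) \<noteq> 0 \<and> flat 1 (b $ i - x $ i) \<noteq> 0)"
    unfolding box_bump_def by (simp add: prod_zero_iff)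
  also have "\<dots> \<longleftrightarrow> x \<in> box a b"
    by (simp add: mem_box_cart flat_eq_0_iff not_le)
  finally show ?thesis .
qed

lemma Cm_box_bump: "Cm m (box_bump a b)" for a b :: "real^'d::finite"
proof -
  have "Cm m (\<lambda>x::real^'d. x $ i + (- (a $ i)))" "Cm m (\<lambda>x::real^'d. b $ i + (-1) * x $ i)" for i
    by (rule Cm_add[OF Cm_nth Cm_const], rule Cm_add[OF Cm_const Cm_mult[OF Cm_const Cm_nth]])
  then have "Cm m (\<lambda>x::real^'d. x $ i - a $ i)" "Cm m (\<lambda>x::real^'d. b $ i - x $ i)" for i
    by simp_all
  then show ?thesis
    unfolding box_bump_def[abs_def] by (intro Cm_prod Cm_mult Cm_flat)
qed

text \<open>
  The boxes are required to be compactly contained in \<open>U\<close>, so that bumps on finitely many of them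
  have compact support in \<open>U\<close>.
\<close>

lemma open_Union_box_seq:
  fixes U :: "'a::euclidean_space set"
  assumes "open U" "U \<noteq> {}"
  obtains a b :: "nat \<Rightarrow> 'a" where "\<And>n. cbox (a n) (b n) \<subseteq> U" "U = (\<Union>n. box (a n) (b n))"
proof -
  define \<F> where "\<F> = {box a b |a b. cbox a b \<subseteq> U}"
  have cover: "\<Union>\<F> = U"
  proof
    show "\<Union>\<F> \<subseteq> U" unfolding \<F>_def using box_subset_cbox by blast
    show "U \<subseteq> \<Union>\<F>"
    proof
      fix x assume "x \<in> U"
      then obtain e where e: "e > 0" "cball x e \<subseteq> U"
        using assms(1) open_contains_cball by blast
      then obtain a b where ab: "x \<in> box a b" "box a b \<subseteq> ball x e"
        using rational_boxes by metis
      have "cbox a b = closure (box a b)" using ab(1) by (metis closure_box empty_iff)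
      also have "\<dots> \<subseteq> closure (ball x e)" using ab(2) by (rule closure_mono)
      also have "\<dots> \<subseteq> U" using e by simp
      finally have "x \<in> box a b" "cbox a b \<subseteq> U" using ab by auto
      then show "x \<in> \<Union>\<F>" unfolding \<F>_def by blast
    qed
  qed
  obtain \<G> where G: "\<G> \<subseteq> \<F>" "countable \<G>" "\<Union>\<G> = \<Union>\<F>"
    using Lindelof[of \<F>] unfolding \<F>_def by (auto simp: open_box)
  have "\<G> \<noteq> {}" using G cover assms(2) by auto
  then obtain X :: "nat \<Rightarrow> 'a set" where X: "range X = \<G>"
    using G(2) uncountable_def by metis
  have "\<forall>n. \<exists>a b. X n = box a b \<and> cbox a b \<subseteq> U"
    using X G(1) unfolding \<F>_def by blast
  then obtain a b where ab: "\<And>n. X n = box (a n) (b n)" "\<And>n. cbox (a n) (b n) \<subseteq> U" by metis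
  show ?thesis
    by (rule that[of a b]) (use ab X G cover in auto)
qed

text \<open>
  Take bumps on a sequence of boxes exhausting \<open>U\<close> and let \<open>s n\<close> be the sum of the first \<open>n\<close>. Then
  \<open>n * s n\<close> tends to infinity on \<open>U\<close> and vanishes outside, and \<open>flat 1\<close> maps this to the limits one and
  zero while keeping all values in the unit interval.
\<close>

lemma test_functions_approx_open:
  fixes U :: "(real^'d::finite) set"
  assumes "open U"
  obtains \<phi> where "\<And>n. \<phi> n \<in> test_functions U" "\<And>n x. \<bar>\<phi> n x\<bar> \<le> 1"
    "\<And>x. (\<lambda>n. \<phi> n x) \<longlonglongrightarrow> indicat_real U x"
proof (cases "U = {}")
  case True
  show ?thesis
    by (rule that[of "\<lambda>_ _. 0"]) (auto simp: test_functions_def Cm_const True)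
next
  case False
  obtain a b :: "nat \<Rightarrow> real^'d" where ab: "\<And>n. cbox (a n) (b n) \<subseteq> U" "U = (\<Union>n. box (a n) (b n))"
    using open_Union_box_seq[OF assms False] by metis
  define s where "s n x = (\<Sum>j<n. box_bump (a j) (b j) x)" for n :: nat and x
  define \<phi> where "\<phi> n x = flat 1 (real n * s n x)" for n x
  have s_outside: "s n x = 0" if "x \<notin> (\<Union>j<n. box (a j) (b j))" for n x
  proof -
    have "box_bump (a j) (b j) x = 0" if "j < n" for j
      using \<open>x \<notin> _\<close> that box_bump_pos_iff[of "a j" "b j" x] box_bump_nonneg[of "a j" "b j" x] by fastforce
    then show ?thesis unfolding s_def by simp
  qed
  show ?thesis
  proof
    fix n x
    show "\<bar>\<phi> n x\<bar> \<le> 1" unfolding \<phi>_def using flat_bounds by simp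
    have K: "compact (\<Union>j<n. cbox (a j) (b j))" by (intro compact_UN) auto
    have sub: "{x. \<phi> n x \<noteq> 0} \<subseteq> (\<Union>j<n. cbox (a j) (b j))"
      using s_outside[of _ n] box_subset_cbox unfolding \<phi>_def flat_def by (fastforce split: if_splits)
    have supp: "closure {x. \<phi> n x \<noteq> 0} \<subseteq> (\<Union>j<n. cbox (a j) (b j))"
      by (rule closure_minimal[OF sub]) (rule compact_imp_closed[OF K])
    have s_smooth: "Cm m (s n)" for m
      unfolding s_def[abs_def] by (rule Cm_sum) (rule Cm_box_bump)
    have smooth: "Cm m (\<phi> n)" for m
      unfolding \<phi>_def[abs_def] by (rule Cm_flat[OF Cm_mult[OF Cm_const s_smooth]])
    have "compact (closure {x. \<phi> n x \<noteq> 0})"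
      unfolding compact_closure by (rule bounded_subset[OF compact_imp_bounded[OF K] sub])
    moreover have "closure {x. \<phi> n x \<noteq> 0} \<subseteq> U" by (rule order_trans[OF supp UN_least]) (rule ab(1))
    ultimately show "\<phi> n \<in> test_functions U"
      unfolding test_functions_def using smooth by simp
    show "(\<lambda>n. \<phi> n x) \<longlonglongrightarrow> indicat_real U x"
    proof (cases "x \<in> U")
      case False
      then have "\<phi> n x = 0" for n using s_outside[of x n] ab(2) unfolding \<phi>_def flat_def by auto
      then show ?thesis using False by simp
    next
      case True
      then obtain k where k: "x \<in> box (a k) (b k)" using ab(2) by blast
      define c where "c = box_bump (a k) (b k) x"
      have c: "c > 0" unfolding c_def using k box_bump_pos_iff by blast
      have "real n * c \<le> real n * s n x" if "n > k" for n
        unfolding c_def s_def using that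
        by (intro mult_left_mono member_le_sum) (auto intro: box_bump_nonneg)
      then have le: "\<forall>\<^sub>F n in sequentially. real n * c \<le> real n * s n x"
        using eventually_gt_at_top[of k] by (rule eventually_mono[rotated])
      have "filterlim (\<lambda>n. real n * c) at_top sequentially"
        using filterlim_tendsto_pos_mult_at_top[OF tendsto_const c filterlim_real_sequentially]
        by (simp add: mult.commute)
      then have "filterlim (\<lambda>n. real n * s n x) at_top sequentially"
        using le by (rule filterlim_at_top_mono)
      from filterlim_compose[OF flat_tendsto_1 this] show ?thesis
        unfolding \<phi>_def using True by simp
    qed
  qed
qed

section \<open>The fundamental lemma of the calculus of variations\<close>

lemma test_functions_mono: "U \<subseteq> \<Omega> \<Longrightarrow> test_functions U \<subseteq> test_functions \<Omega>"
  unfolding test_functions_def by blast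

lemma test_function_continuous: "\<phi> \<in> test_functions \<Omega> \<Longrightarrow> continuous_on UNIV \<phi>"
  unfolding test_functions_def using Cm_continuous by blast

lemma test_function_partial_deriv_continuous:
  assumes "\<phi> \<in> test_functions \<Omega>"
  shows "continuous_on UNIV (partial_deriv i \<phi>)"
proof -
  have "Cm (Suc 0) \<phi>" using assms unfolding test_functions_def by blast
  then show ?thesis by simp
qed

lemma test_function_differentiable:
  assumes "\<phi> \<in> test_functions \<Omega>"
  shows "(\<phi> has_derivative frechet_derivative \<phi> (at x)) (at x)"
proof -
  have "Cm (Suc 0) \<phi>" using assms unfolding test_functions_def by blast
  then show ?thesis by (rule Cm_SucE)
qed

lemma continuous_on_UNIV_measurable_lebesgue_on:
  fixes f :: "'a::euclidean_space \<Rightarrow> real"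
  assumes "continuous_on UNIV f" "S \<in> sets lebesgue"
  shows "f \<in> borel_measurable (lebesgue_on S)"
  by (rule continuous_imp_measurable_on_sets_lebesgue)
     (use assms continuous_on_subset in auto)

text \<open>
  Dominated convergence along test functions that converge to the indicator of \<open>U\<close>.
\<close>

lemma integral_over_open_eq_0:
  fixes \<Omega> :: "(real^'d::finite) set"
  assumes \<Omega>: "open \<Omega>" and g: "integrable (lebesgue_on \<Omega>) g"
    and test: "\<And>\<phi>. \<phi> \<in> test_functions \<Omega> \<Longrightarrow> integ \<Omega> (\<lambda>x. g x * \<phi> x) = 0"
    and U: "open U" "U \<subseteq> \<Omega>"
  shows "integral\<^sup>L (lebesgue_on \<Omega>) (\<lambda>x. g x * indicat_real U x) = 0"
proof -
  have meas: "\<Omega> \<in> sets lebesgue" using \<Omega> by (simp add: lebesgue_openin)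
  obtain \<phi> where \<phi>: "\<And>n. \<phi> n \<in> test_functions U" "\<And>n x. \<bar>\<phi> n x\<bar> \<le> 1"
    "\<And>x. (\<lambda>n. \<phi> n x) \<longlonglongrightarrow> indicat_real U x"
    using test_functions_approx_open[OF U(1)] by blast
  have [measurable]: "g \<in> borel_measurable (lebesgue_on \<Omega>)" using g by simp
  have \<phi>_meas[measurable]: "\<phi> n \<in> borel_measurable (lebesgue_on \<Omega>)" for n
    by (rule continuous_on_UNIV_measurable_lebesgue_on[OF test_function_continuous[OF \<phi>(1)] meas])
  have ind[measurable]: "indicat_real U \<in> borel_measurable (lebesgue_on \<Omega>)"
    by (rule borel_measurable_LIMSEQ_real[OF \<phi>(3) \<phi>_meas])
  have "(\<lambda>n. integral\<^sup>L (lebesgue_on \<Omega>) (\<lambda>x. g x * \<phi> n x)) \<longlonglongrightarrow>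
        integral\<^sup>L (lebesgue_on \<Omega>) (\<lambda>x. g x * indicat_real U x)"
  proof (rule integral_dominated_convergence[where w = "\<lambda>x. \<bar>g x\<bar>"])
    show "integrable (lebesgue_on \<Omega>) (\<lambda>x. \<bar>g x\<bar>)" using g by (rule integrable_abs)
    show "AE x in lebesgue_on \<Omega>. (\<lambda>n. g x * \<phi> n x) \<longlonglongrightarrow> g x * indicat_real U x"
      by (intro AE_I2 tendsto_mult tendsto_const \<phi>(3))
    show "AE x in lebesgue_on \<Omega>. norm (g x * \<phi> n x) \<le> \<bar>g x\<bar>" for n
      using \<phi>(2)[of n] by (intro AE_I2) (simp add: abs_mult mult_left_le)
  qed measurable
  moreover have "integral\<^sup>L (lebesgue_on \<Omega>) (\<lambda>x. g x * \<phi> n x) = 0" for n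
    using test \<phi>(1) test_functions_mono[OF U(2)] unfolding integ_def by blast
  ultimately show ?thesis by (simp add: LIMSEQ_const_iff)
qed

text \<open>
  Completion keeps a sigma-finite exhaustion by Borel sets; averaging arguments require it.
\<close>

lemma sigma_finite_lebesgue: "sigma_finite_measure (lebesgue :: 'a::euclidean_space measure)"
proof
  obtain A :: "'a set set" where "countable A" "A \<subseteq> sets lborel" "\<Union>A = space lborel"
    "\<forall>a\<in>A. emeasure lborel a \<noteq> \<infinity>"
    using lborel.sigma_finite_countable by blast
  then show "\<exists>A :: 'a set set. countable A \<and> A \<subseteq> sets lebesgue \<and> \<Union>A = space lebesgue \<and>
      (\<forall>a\<in>A. emeasure lebesgue a \<noteq> \<infinity>)"
    by (intro exI[of _ A]) (auto simp: subset_iff)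
qed

text \<open>
  The integral of \<open>g\<close> over open sets vanishes. Open sets form an intersection-stable generator of the
  Borel sets, so the integral over Borel sets, and after discarding null sets over Lebesgue sets,
  vanishes too.
\<close>

lemma fundamental_lemma_calculus_of_variations:
  fixes \<Omega> :: "(real^'d::finite) set"
  assumes \<Omega>: "open \<Omega>" and g: "integrable (lebesgue_on \<Omega>) g"
    and test: "\<And>\<phi>. \<phi> \<in> test_functions \<Omega> \<Longrightarrow> integ \<Omega> (\<lambda>x. g x * \<phi> x) = 0"
  shows "AE x in lebesgue_on \<Omega>. g x = 0"
proof -
  have meas: "\<Omega> \<in> sets lebesgue" using \<Omega> by (simp add: lebesgue_openin)
  \<comment> \<open>Extension by zero, so that complements in the induction over Borel sets are taken in the whole space.\<close>
  define g0 where "g0 x = indicat_real \<Omega> x * g x" for x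
  have g0: "integrable lebesgue g0"
    using g integrable_restrict_space[of \<Omega> lebesgue g] meas unfolding g0_def by simp
  have g0_meas: "g0 \<in> borel_measurable lebesgue" using g0 by simp
  have g0_set: "set_integrable lebesgue A g0" if "A \<in> sets lebesgue" for A
    unfolding set_integrable_def by (rule integrable_mult_indicator[OF that g0])
  have opens: "set_lebesgue_integral lebesgue U g0 = 0" if U: "open U" for U
  proof -
    have "set_lebesgue_integral lebesgue U g0 = (LINT x|lebesgue. indicat_real \<Omega> x *\<^sub>R (g x * indicat_real (U \<inter> \<Omega>) x))"
      unfolding set_lebesgue_integral_def g0_def by (rule Bochner_Integration.integral_cong) (auto simp: indicator_def)
    also have "\<dots> = integral\<^sup>L (lebesgue_on \<Omega>) (\<lambda>x. g x * indicat_real (U \<inter> \<Omega>) x)"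
      by (rule integral_restrict_space[symmetric]) (use meas in simp)
    also have "\<dots> = 0"
      by (rule integral_over_open_eq_0[OF \<Omega> g test]) (use U \<Omega> in auto)
    finally show ?thesis .
  qed
  have borels: "set_lebesgue_integral lebesgue A g0 = 0 \<and> A \<in> sets lebesgue" if "A \<in> sets borel" for A
  proof -
    have "Int_stable {S::(real^'d) set. open S}" by (auto simp: Int_stable_def)
    moreover have "{S::(real^'d) set. open S} \<subseteq> Pow UNIV" by simp
    moreover have "A \<in> sigma_sets UNIV {S::(real^'d) set. open S}" using that by (simp add: borel_def)
    ultimately show ?thesis
    proof (induction rule: sigma_sets_induct_disjoint[consumes 3, case_names basic empty compl union])
      case (basic A)
      then show ?case using opens by (simp add: lebesgue_openin)
    next
      case empty
      then show ?case by (simp add: set_lebesgue_integral_def)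
    next
      case (compl A)
      have sets: "UNIV - A \<in> sets lebesgue" using compl sets.compl_sets[of A lebesgue] by simp
      have "set_lebesgue_integral lebesgue (A \<union> (UNIV - A)) g0 = set_lebesgue_integral lebesgue A g0 + set_lebesgue_integral lebesgue (UNIV - A) g0"
        by (rule set_integral_Un) (use compl sets g0_set in auto)
      moreover have "A \<union> (UNIV - A) = UNIV" by blast
      ultimately show ?case using compl opens[of UNIV] sets by simp
    next
      case (union A)
      have "\<Union>(range A) \<in> sets lebesgue" using union by blast
      moreover have "(LINT x:(\<Union>i. A i)|lebesgue. g0 x) = (\<Sum>i. (LINT x:(A i)|lebesgue. g0 x))"
        by (rule lebesgue_integral_countable_add)
           (use union g0_set calculation in \<open>auto simp: disjoint_family_on_def\<close>)
      ultimately show ?case using union by simp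
    qed
  qed
  have "AE x in lebesgue. g0 x = 0"
  proof (rule sigma_finite_measure.density_zero[OF sigma_finite_lebesgue g0])
    fix A :: "(real^'d) set" assume A: "A \<in> sets lebesgue"
    then obtain S N N' where SN: "A = S \<union> N" "N \<subseteq> N'" "N' \<in> null_sets lborel" "S \<in> sets lborel"
      by (rule sets_completionE)
    have "N \<in> null_sets lebesgue"
      using SN null_sets_completion_subset null_sets_completionI by metis
    then have "AE x in lebesgue. x \<notin> N" by (rule AE_not_in)
    then have "AE x in lebesgue. indicat_real A x *\<^sub>R g0 x = indicat_real S x *\<^sub>R g0 x"
      by eventually_elim (auto simp: SN(1) indicator_def)
    then have "set_lebesgue_integral lebesgue A g0 = set_lebesgue_integral lebesgue S g0"
      unfolding set_lebesgue_integral_def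
      by (intro integral_cong_AE) (use A SN g0_set in \<open>auto simp: set_integrable_def intro!: borel_measurable_integrable\<close>)
    then show "set_lebesgue_integral lebesgue A g0 = 0" using borels[of S] SN by simp
  qed
  then have "AE x in lebesgue. x \<in> \<Omega> \<longrightarrow> g x = 0"
    by eventually_elim (auto simp: g0_def indicator_def)
  then show ?thesis using AE_restrict_space_iff[of \<Omega> lebesgue] meas by simp
qed

text \<open>
  The integral of \<open>\<phi>\<close> is invariant under translation, so every difference quotient of \<open>\<phi>\<close> has integral
  zero. The quotients converge to the partial derivative; by the mean value theorem they are bounded
  by its maximum, and they are supported in a fixed ball.
\<close>

lemma integ_partial_deriv_test_function:
  fixes \<Omega> :: "(real^'d::finite) set"
  assumes \<Omega>: "open \<Omega>" and \<phi>: "\<phi> \<in> test_functions \<Omega>"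
  shows "integ \<Omega> (partial_deriv i \<phi>) = 0"
proof -
  define \<psi> where "\<psi> = partial_deriv i \<phi>"
  define e where "e = (axis i 1 :: real^'d)"
  define K where "K = closure {x. \<phi> x \<noteq> 0}"
  have K: "compact K" "K \<subseteq> \<Omega>" using \<phi> unfolding test_functions_def K_def by auto
  have cont: "continuous_on UNIV \<phi>" "continuous_on UNIV \<psi>"
    using test_function_continuous[OF \<phi>] test_function_partial_deriv_continuous[OF \<phi>] unfolding \<psi>_def by auto
  have meas[measurable]: "\<phi> \<in> borel_measurable borel" "\<psi> \<in> borel_measurable borel"
    using cont by (auto intro: borel_measurable_continuous_onI)
  have \<phi>0: "\<phi> x = 0" if "x \<notin> K" for x
    using that closure_subset[of "{x. \<phi> x \<noteq> 0}"] unfolding K_def by auto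
  have \<psi>0: "\<psi> x = 0" if "x \<notin> K" for x
  proof -
    have "open (- K)" using compact_imp_closed[OF K(1)] by (rule open_Compl)
    then have "(\<phi> has_derivative (\<lambda>_. 0)) (at x)"
      by (rule has_derivative_transform_within_open[OF has_derivative_const]) (use \<phi>0 that in auto)
    then show ?thesis unfolding \<psi>_def by (simp add: partial_deriv_eqI)
  qed
  have line: "((\<lambda>t. \<phi> (x + t *\<^sub>R e)) has_real_derivative \<psi> (x + t *\<^sub>R e)) (at t)" for x t
  proof -
    have "((\<lambda>t. x + t *\<^sub>R e) has_derivative (\<lambda>h. h *\<^sub>R e)) (at t)"
      by (auto intro!: derivative_eq_intros)
    from has_derivative_compose[OF this test_function_differentiable[OF \<phi>]]
    have "((\<lambda>t. \<phi> (x + t *\<^sub>R e)) has_derivative (\<lambda>h. frechet_derivative \<phi> (at (x + t *\<^sub>R e)) (h *\<^sub>R e))) (at t)" .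
    moreover have "frechet_derivative \<phi> (at y) (h *\<^sub>R e) = \<psi> y * h" for y h
      using linear_scale[OF has_derivative_linear[OF test_function_differentiable[OF \<phi>, of y]], of h e]
      unfolding \<psi>_def partial_deriv_def e_def by simp
    ultimately show ?thesis unfolding has_field_derivative_def
      by (simp only: fun_eq_iff)
  qed
  obtain R where R: "\<And>x. x \<in> K \<Longrightarrow> norm x \<le> R" 
    using compact_imp_bounded[OF K(1)] unfolding bounded_iff by blast
  have "bounded (\<psi> ` K)"
    by (rule compact_imp_bounded[OF compact_continuous_image[OF continuous_on_subset[OF cont(2)] K(1)]]) simp
  then obtain C where C: "\<And>x. x \<in> K \<Longrightarrow> \<bar>\<psi> x\<bar> \<le> C" "C > 0"
    unfolding bounded_pos by auto
  have \<psi>C: "\<bar>\<psi> x\<bar> \<le> C" for x using C \<psi>0[of x] by (cases "x \<in> K") auto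
  have ball_int: "integrable lborel (\<lambda>x::real^'d. indicat_real (cball 0 r) x *\<^sub>R f x)" if "continuous_on UNIV f" for r and f :: "real^'d \<Rightarrow> real"
    using borel_integrable_compact[OF compact_cball continuous_on_subset[OF that]] by simp
  have \<phi>_int: "integrable lborel \<phi>"
  proof -
    have "(\<lambda>x. indicat_real (cball 0 R) x *\<^sub>R \<phi> x) = \<phi>"
      using R \<phi>0 by (auto simp: indicator_def fun_eq_iff)
    then show ?thesis using ball_int[OF cont(1), of R] by simp
  qed
  define h where "h n = inverse (real (Suc n))" for n
  have h: "0 < h n" "h n \<le> 1" for n unfolding h_def by (auto simp: inverse_le_1_iff)
  \<comment> \<open>Steps are at most one, so the quotients are supported in the ball of radius \<open>R + 1\<close>.\<close>
  define q where "q n x = (\<phi> (x + h n *\<^sub>R e) - \<phi> x) / h n" for n x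
  have shift: "integrable lborel (\<lambda>x. \<phi> (x + c)) \<and> (LINT x|lborel. \<phi> (x + c)) = (LINT x|lborel. \<phi> x)" for c
    using \<phi>_int integrable_distr_eq[of "(+) c" lborel borel \<phi>] integral_distr[of "(+) c" lborel borel \<phi>]
    by (simp add: lborel_distr_plus add.commute)
  have q_int: "(LINT x|lborel. q n x) = 0" for n
    unfolding q_def using shift \<phi>_int by simp
  have "(\<lambda>n. LINT x|lborel. q n x) \<longlonglongrightarrow> (LINT x|lborel. \<psi> x)"
  proof (rule integral_dominated_convergence[where w = "\<lambda>x. indicat_real (cball 0 (R + 1)) x *\<^sub>R C"])
    show "integrable lborel (\<lambda>x::real^'d. indicat_real (cball 0 (R + 1)) x *\<^sub>R C)"
      by (rule ball_int[OF continuous_on_const])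
    show "AE x in lborel. (\<lambda>n. q n x) \<longlonglongrightarrow> \<psi> x"
    proof (rule AE_I2)
      fix x
      have "((\<lambda>t. (\<phi> (x + t *\<^sub>R e) - \<phi> x) / t) \<longlongrightarrow> \<psi> x) (at 0)"
        using line[of x 0] unfolding has_field_derivative_iff by simp
      moreover have "filterlim h (at 0) sequentially"
        unfolding filterlim_at h_def using LIMSEQ_inverse_real_of_nat by simp
      ultimately show "(\<lambda>n. q n x) \<longlonglongrightarrow> \<psi> x"
        unfolding q_def by (rule filterlim_compose)
    qed
    show "AE x in lborel. norm (q n x) \<le> indicat_real (cball 0 (R + 1)) x *\<^sub>R C" for n
    proof (rule AE_I2)
      fix x
      obtain z where "\<phi> (x + h n *\<^sub>R e) - \<phi> (x + 0 *\<^sub>R e) = (h n - 0) * \<psi> (x + z *\<^sub>R e)"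
        using MVT2[OF h(1)[of n], of "\<lambda>t. \<phi> (x + t *\<^sub>R e)" "\<lambda>t. \<psi> (x + t *\<^sub>R e)"] line by blast
      then have "q n x = \<psi> (x + z *\<^sub>R e)" unfolding q_def using h(1)[of n] by (simp add: field_simps)
      then have bound: "\<bar>q n x\<bar> \<le> C" using \<psi>C by simp
      have "q n x = 0" if "norm x > R + 1"
      proof -
        have "norm x \<le> norm (x + h n *\<^sub>R e) + norm (h n *\<^sub>R e)"
          using norm_triangle_ineq4[of "x + h n *\<^sub>R e" "h n *\<^sub>R e"] by simp
        moreover have "norm (h n *\<^sub>R e) \<le> 1" using h[of n] by (simp add: e_def)
        ultimately have "x \<notin> K" "x + h n *\<^sub>R e \<notin> K" using R[of x] R[of "x + h n *\<^sub>R e"] that by auto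
        then show ?thesis unfolding q_def using \<phi>0 by simp
      qed
      then show "norm (q n x) \<le> indicat_real (cball 0 (R + 1)) x *\<^sub>R C"
        using bound C(2) by (auto simp: indicator_def)
    qed
  qed (auto simp: q_def)
  then have "(LINT x|lborel. \<psi> x) = 0" by (simp add: q_int LIMSEQ_const_iff)
  then have "(LINT x|lebesgue. \<psi> x) = 0" by (simp add: integral_completion)
  moreover have "integ \<Omega> \<psi> = (LINT x|lebesgue. \<psi> x)"
  proof -
    have "integ \<Omega> \<psi> = (LINT x|lebesgue. indicat_real \<Omega> x *\<^sub>R \<psi> x)"
      unfolding integ_def by (rule integral_restrict_space) (use \<Omega> in \<open>simp add: lebesgue_openin\<close>)
    also have "(\<lambda>x. indicat_real \<Omega> x *\<^sub>R \<psi> x) = \<psi>"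
      using K(2) \<psi>0 by (auto simp: indicator_def fun_eq_iff)
    finally show ?thesis .
  qed
  ultimately show ?thesis unfolding \<psi>_def by simp
qed

section \<open>Weak gradients and the form \<open>A\<close>\<close>

lemma finite_measure_lebesgue_on_bounded:
  fixes \<Omega> :: "'a::euclidean_space set"
  assumes "open \<Omega>" "bounded \<Omega>"
  shows "finite_measure (lebesgue_on \<Omega>)"
  using assms by (simp add: finite_measure_lebesgue_on lmeasurable_open)

lemma L2_measurable: "f \<in> L2 \<Omega> \<Longrightarrow> f \<in> borel_measurable (lebesgue_on \<Omega>)"
  unfolding L2_def by simp

lemma L2_square_integrable: "f \<in> L2 \<Omega> \<Longrightarrow> integrable (lebesgue_on \<Omega>) (\<lambda>x. (norm (f x))\<^sup>2)"
  unfolding L2_def by simp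

text \<open>
  Stated for inner products because it is applied to functions and to gradients alike.
\<close>

lemma L2_inner_integrable:
  assumes f: "f \<in> L2 \<Omega>" and g: "g \<in> L2 \<Omega>"
  shows "integrable (lebesgue_on \<Omega>) (\<lambda>x. f x \<bullet> g x)"
proof (rule Bochner_Integration.integrable_bound)
  show "integrable (lebesgue_on \<Omega>) (\<lambda>x. (norm (f x))\<^sup>2 + (norm (g x))\<^sup>2)"
    by (intro Bochner_Integration.integrable_add L2_square_integrable f g)
  show "(\<lambda>x. f x \<bullet> g x) \<in> borel_measurable (lebesgue_on \<Omega>)"
    by (intro borel_measurable_inner L2_measurable f g)
  show "AE x in lebesgue_on \<Omega>. norm (f x \<bullet> g x) \<le> norm ((norm (f x))\<^sup>2 + (norm (g x))\<^sup>2)"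
  proof (rule AE_I2)
    fix x
    have "\<bar>f x \<bullet> g x\<bar> \<le> norm (f x) * norm (g x)" by (rule Cauchy_Schwarz_ineq2)
    also have "\<dots> \<le> 2 * (norm (f x) * norm (g x))" by simp
    also have "\<dots> \<le> (norm (f x))\<^sup>2 + (norm (g x))\<^sup>2"
      using sum_squares_bound[of "norm (f x)" "norm (g x)"] by (simp add: mult.assoc)
    finally show "norm (f x \<bullet> g x) \<le> norm ((norm (f x))\<^sup>2 + (norm (g x))\<^sup>2)" by simp
  qed
qed

lemma L2_mult_integrable:
  "f \<in> L2 \<Omega> \<Longrightarrow> g \<in> L2 \<Omega> \<Longrightarrow> integrable (lebesgue_on \<Omega>) (\<lambda>x. f x * g x :: real)"
  using L2_inner_integrable[of f \<Omega> g] by simp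

lemma L2_add:
  assumes f: "f \<in> L2 \<Omega>" and g: "g \<in> L2 \<Omega>"
  shows "(\<lambda>x. f x + g x) \<in> L2 \<Omega>"
proof -
  have "integrable (lebesgue_on \<Omega>) (\<lambda>x. (norm (f x))\<^sup>2 + 2 * (f x \<bullet> g x) + (norm (g x))\<^sup>2)"
    by (intro Bochner_Integration.integrable_add integrable_mult_right L2_square_integrable L2_inner_integrable f g)
  moreover have "(norm (a + b))\<^sup>2 = (norm a)\<^sup>2 + 2 * (a \<bullet> b) + (norm b)\<^sup>2" for a b :: 'b
    by (simp add: power2_norm_eq_inner inner_add_left inner_add_right inner_commute)
  moreover have "(\<lambda>x. f x + g x) \<in> borel_measurable (lebesgue_on \<Omega>)"
    by (intro borel_measurable_add L2_measurable f g)
  ultimately show ?thesis unfolding L2_def by simp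
qed

lemma L2_scale: "f \<in> L2 \<Omega> \<Longrightarrow> (\<lambda>x. c *\<^sub>R f x) \<in> L2 \<Omega>"
  unfolding L2_def by (auto simp: power_mult_distrib)

lemma L2_nth:
  fixes g :: "'a::euclidean_space \<Rightarrow> real^'d::finite"
  assumes g: "g \<in> L2 \<Omega>"
  shows "(\<lambda>x. g x $ i) \<in> L2 \<Omega>"
proof -
  have m: "(\<lambda>x. g x $ i) \<in> borel_measurable (lebesgue_on \<Omega>)"
  proof -
    have "(\<lambda>x. g x \<bullet> axis i 1) \<in> borel_measurable (lebesgue_on \<Omega>)"
      by (intro borel_measurable_inner L2_measurable g borel_measurable_const)
    then show ?thesis by (simp add: inner_axis)
  qed
  moreover have "integrable (lebesgue_on \<Omega>) (\<lambda>x. (norm (g x $ i))\<^sup>2)"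
  proof (rule Bochner_Integration.integrable_bound)
    show "integrable (lebesgue_on \<Omega>) (\<lambda>x. (norm (g x))\<^sup>2)" using g unfolding L2_def by simp
    show "(\<lambda>x. (norm (g x $ i))\<^sup>2) \<in> borel_measurable (lebesgue_on \<Omega>)" using m by simp
    show "AE x in lebesgue_on \<Omega>. norm ((norm (g x $ i))\<^sup>2) \<le> norm ((norm (g x))\<^sup>2)"
      using component_le_norm_cart[of _ i] by (intro AE_I2) (simp add: abs_le_square_iff[symmetric])
  qed
  ultimately show ?thesis unfolding L2_def by simp
qed

lemma bounded_measurable_in_L2:
  fixes f :: "'a::euclidean_space \<Rightarrow> 'b::euclidean_space"
  assumes \<Omega>: "open \<Omega>" "bounded \<Omega>" and f: "f \<in> borel_measurable (lebesgue_on \<Omega>)"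
    and C: "\<And>x. x \<in> \<Omega> \<Longrightarrow> norm (f x) \<le> C"
  shows "f \<in> L2 \<Omega>"
proof -
  interpret finite_measure "lebesgue_on \<Omega>" by (rule finite_measure_lebesgue_on_bounded[OF \<Omega>])
  have "integrable (lebesgue_on \<Omega>) (\<lambda>x. (norm (f x))\<^sup>2)"
  proof (rule integrable_const_bound[where B = "C\<^sup>2"])
    show "AE x in lebesgue_on \<Omega>. norm ((norm (f x))\<^sup>2) \<le> C\<^sup>2"
      by (rule AE_I2) (use C in \<open>auto intro: power_mono\<close>)
    show "(\<lambda>x. (norm (f x))\<^sup>2) \<in> borel_measurable (lebesgue_on \<Omega>)" using f by simp
  qed
  then show ?thesis using f unfolding L2_def by simp
qed

lemma continuous_on_closure_bounded_measurable:
  fixes f :: "'a::euclidean_space \<Rightarrow> real"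
  assumes \<Omega>: "open \<Omega>" "bounded \<Omega>" and f: "continuous_on (closure \<Omega>) f"
  obtains C where "f \<in> borel_measurable (lebesgue_on \<Omega>)" "\<And>x. x \<in> \<Omega> \<Longrightarrow> \<bar>f x\<bar> \<le> C"
proof -
  have "continuous_on \<Omega> f" using f closure_subset by (rule continuous_on_subset)
  then have m: "f \<in> borel_measurable (lebesgue_on \<Omega>)"
    by (rule continuous_imp_measurable_on_sets_lebesgue) (use \<Omega> in \<open>simp add: lebesgue_openin\<close>)
  have "compact (closure \<Omega>)" using \<Omega> by simp
  then have "bounded (f ` closure \<Omega>)" using f by (intro compact_imp_bounded compact_continuous_image)
  then obtain C where "\<And>x. x \<in> closure \<Omega> \<Longrightarrow> \<bar>f x\<bar> \<le> C" unfolding bounded_iff by auto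
  then show ?thesis using that m closure_subset by blast
qed

lemma continuous_on_closure_in_L2:
  fixes f :: "'a::euclidean_space \<Rightarrow> real"
  assumes \<Omega>: "open \<Omega>" "bounded \<Omega>" and f: "continuous_on (closure \<Omega>) f"
  shows "f \<in> L2 \<Omega>"
proof -
  obtain C where "f \<in> borel_measurable (lebesgue_on \<Omega>)" "\<And>x. x \<in> \<Omega> \<Longrightarrow> \<bar>f x\<bar> \<le> C"
    using continuous_on_closure_bounded_measurable[OF assms] by blast
  then show ?thesis using bounded_measurable_in_L2[OF \<Omega>, of f C] by simp
qed

lemma L2_integrable:
  assumes \<Omega>: "open \<Omega>" "bounded \<Omega>" and f: "f \<in> L2 \<Omega>"
  shows "integrable (lebesgue_on \<Omega>) (f :: _ \<Rightarrow> real)"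
proof -
  have "(\<lambda>_. 1 :: real) \<in> L2 \<Omega>" by (rule continuous_on_closure_in_L2[OF \<Omega> continuous_on_const])
  from L2_mult_integrable[OF f this] show ?thesis by simp
qed

lemma test_function_in_L2:
  fixes \<Omega> :: "(real^'d::finite) set"
  assumes \<Omega>: "open \<Omega>" "bounded \<Omega>" and \<phi>: "\<phi> \<in> test_functions \<Omega>"
  shows "\<phi> \<in> L2 \<Omega>" "partial_deriv i \<phi> \<in> L2 \<Omega>"
  by (rule continuous_on_closure_in_L2[OF \<Omega>],
      rule continuous_on_subset[OF test_function_continuous[OF \<phi>]], simp)
     (rule continuous_on_closure_in_L2[OF \<Omega>],
      rule continuous_on_subset[OF test_function_partial_deriv_continuous[OF \<phi>]], simp)

lemma is_weak_grad_add:
  fixes \<Omega> :: "(real^'d::finite) set"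
  assumes \<Omega>: "open \<Omega>" "bounded \<Omega>" and L2: "u \<in> L2 \<Omega>" "v \<in> L2 \<Omega>" "g \<in> L2 \<Omega>" "h \<in> L2 \<Omega>"
    and weak: "is_weak_grad \<Omega> u g" "is_weak_grad \<Omega> v h"
  shows "is_weak_grad \<Omega> (\<lambda>x. u x + v x) (\<lambda>x. g x + h x)"
  unfolding is_weak_grad_def
proof (intro ballI allI)
  fix \<phi> i assume \<phi>: "\<phi> \<in> test_functions \<Omega>"
  note tf = test_function_in_L2[OF \<Omega> \<phi>]
  have "integ \<Omega> (\<lambda>x. (u x + v x) * partial_deriv i \<phi> x)
      = integ \<Omega> (\<lambda>x. u x * partial_deriv i \<phi> x) + integ \<Omega> (\<lambda>x. v x * partial_deriv i \<phi> x)"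
    unfolding integ_def distrib_right
    by (rule Bochner_Integration.integral_add) (rule L2_mult_integrable L2 tf)+
  also have "\<dots> = - (integ \<Omega> (\<lambda>x. g x $ i * \<phi> x) + integ \<Omega> (\<lambda>x. h x $ i * \<phi> x))"
    using weak \<phi> unfolding is_weak_grad_def by simp
  also have "\<dots> = - integ \<Omega> (\<lambda>x. (g x + h x) $ i * \<phi> x)"
    unfolding integ_def vector_add_component distrib_right
    by (subst Bochner_Integration.integral_add) (rule L2_mult_integrable L2_nth L2 tf refl)+
  finally show "integ \<Omega> (\<lambda>x. (u x + v x) * partial_deriv i \<phi> x) = - integ \<Omega> (\<lambda>x. (g x + h x) $ i * \<phi> x)" .
qed

lemma is_weak_grad_scale:
  assumes "is_weak_grad \<Omega> u g"
  shows "is_weak_grad \<Omega> (\<lambda>x. c *\<^sub>R u x) (\<lambda>x. c *\<^sub>R g x)"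
  using assms unfolding is_weak_grad_def integ_def by (simp add: mult.assoc)

text \<open>
  Each component of the difference is orthogonal to all test functions.
\<close>

lemma is_weak_grad_unique:
  fixes \<Omega> :: "(real^'d::finite) set"
  assumes \<Omega>: "open \<Omega>" "bounded \<Omega>" and L2: "g \<in> L2 \<Omega>" "h \<in> L2 \<Omega>"
    and weak: "is_weak_grad \<Omega> v g" "is_weak_grad \<Omega> v h"
  shows "AE x in lebesgue_on \<Omega>. g x = h x"
proof -
  have "AE x in lebesgue_on \<Omega>. g x $ i - h x $ i = 0" for i
  proof (rule fundamental_lemma_calculus_of_variations[OF \<Omega>(1)])
    show "integrable (lebesgue_on \<Omega>) (\<lambda>x. g x $ i - h x $ i)"
      by (intro Bochner_Integration.integrable_diff L2_integrable[OF \<Omega>] L2_nth L2)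
    fix \<phi> assume \<phi>: "\<phi> \<in> test_functions \<Omega>"
    note tf = test_function_in_L2[OF \<Omega> \<phi>]
    have "integ \<Omega> (\<lambda>x. (g x $ i - h x $ i) * \<phi> x) = integ \<Omega> (\<lambda>x. g x $ i * \<phi> x) - integ \<Omega> (\<lambda>x. h x $ i * \<phi> x)"
      unfolding integ_def left_diff_distrib
      by (rule Bochner_Integration.integral_diff) (rule L2_mult_integrable L2_nth L2 tf)+
    also have "\<dots> = 0"
    proof -
      have "integ \<Omega> (\<lambda>x. v x * partial_deriv i \<phi> x) = - integ \<Omega> (\<lambda>x. g x $ i * \<phi> x)"
        "integ \<Omega> (\<lambda>x. v x * partial_deriv i \<phi> x) = - integ \<Omega> (\<lambda>x. h x $ i * \<phi> x)"
        using weak \<phi> unfolding is_weak_grad_def by blast+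
      then show ?thesis by linarith
    qed
    finally show "integ \<Omega> (\<lambda>x. (g x $ i - h x $ i) * \<phi> x) = 0" .
  qed
  then have "AE x in lebesgue_on \<Omega>. \<forall>i. g x $ i - h x $ i = 0"
    by (rule eventually_all_finite)
  then show ?thesis by eventually_elim (simp add: vec_eq_iff)
qed

lemma weak_grad_H1:
  assumes "v \<in> H1 \<Omega>"
  shows "weak_grad \<Omega> v \<in> L2 \<Omega>" "is_weak_grad \<Omega> v (weak_grad \<Omega> v)"
proof -
  have "\<exists>g. g \<in> L2 \<Omega> \<and> is_weak_grad \<Omega> v g" using assms unfolding H1_def by blast
  from someI_ex[OF this] show "weak_grad \<Omega> v \<in> L2 \<Omega>" "is_weak_grad \<Omega> v (weak_grad \<Omega> v)"
    unfolding weak_grad_def by simp_all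
qed

text \<open>
  The only way in which the chosen representative \<open>weak_grad \<Omega> v\<close> is ever evaluated: exhibit some weak
  gradient and compare.
\<close>

lemma weak_grad_eq_AE:
  fixes \<Omega> :: "(real^'d::finite) set"
  assumes \<Omega>: "open \<Omega>" "bounded \<Omega>" and v: "v \<in> L2 \<Omega>" and g: "g \<in> L2 \<Omega>" "is_weak_grad \<Omega> v g"
  shows "v \<in> H1 \<Omega>" "AE x in lebesgue_on \<Omega>. weak_grad \<Omega> v x = g x"
proof -
  show v: "v \<in> H1 \<Omega>" using v g unfolding H1_def by blast
  show "AE x in lebesgue_on \<Omega>. weak_grad \<Omega> v x = g x"
    by (rule is_weak_grad_unique[OF \<Omega> weak_grad_H1(1)[OF v] g(1) weak_grad_H1(2)[OF v] g(2)])
qed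

lemma H1_imp_L2: "v \<in> H1 \<Omega> \<Longrightarrow> v \<in> L2 \<Omega>"
  unfolding H1_def by simp

lemma H1_add:
  fixes \<Omega> :: "(real^'d::finite) set"
  assumes \<Omega>: "open \<Omega>" "bounded \<Omega>" and uv: "u \<in> H1 \<Omega>" "v \<in> H1 \<Omega>"
  shows "u + v \<in> H1 \<Omega>" "AE x in lebesgue_on \<Omega>. weak_grad \<Omega> (u + v) x = weak_grad \<Omega> u x + weak_grad \<Omega> v x"
proof -
  note L2 = H1_imp_L2[OF uv(1)] H1_imp_L2[OF uv(2)] weak_grad_H1(1)[OF uv(1)] weak_grad_H1(1)[OF uv(2)]
  note grad = is_weak_grad_add[OF \<Omega> L2 weak_grad_H1(2)[OF uv(1)] weak_grad_H1(2)[OF uv(2)]]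
  show "u + v \<in> H1 \<Omega>" "AE x in lebesgue_on \<Omega>. weak_grad \<Omega> (u + v) x = weak_grad \<Omega> u x + weak_grad \<Omega> v x"
    unfolding plus_fun_def using weak_grad_eq_AE[OF \<Omega> L2_add[OF L2(1,2)] L2_add[OF L2(3,4)] grad] .
qed

lemma H1_scale:
  fixes \<Omega> :: "(real^'d::finite) set"
  assumes \<Omega>: "open \<Omega>" "bounded \<Omega>" and u: "u \<in> H1 \<Omega>"
  shows "c *\<^sub>R u \<in> H1 \<Omega>" "AE x in lebesgue_on \<Omega>. weak_grad \<Omega> (c *\<^sub>R u) x = c *\<^sub>R weak_grad \<Omega> u x"
proof -
  note grad = weak_grad_eq_AE[OF \<Omega> L2_scale[OF H1_imp_L2[OF u]] L2_scale[OF weak_grad_H1(1)[OF u]]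
      is_weak_grad_scale[OF weak_grad_H1(2)[OF u]]]
  show "c *\<^sub>R u \<in> H1 \<Omega>" "AE x in lebesgue_on \<Omega>. weak_grad \<Omega> (c *\<^sub>R u) x = c *\<^sub>R weak_grad \<Omega> u x"
    unfolding scaleR_fun_def using grad .
qed

text \<open>
  The constant function one appears as the indicator of \<open>closure \<Omega>\<close> because elements of \<open>C0 \<Omega>\<close> are
  extended by zero.
\<close>

lemma constant_in_H1:
  fixes \<Omega> :: "(real^'d::finite) set"
  assumes \<Omega>: "open \<Omega>" "bounded \<Omega>"
  shows "indicat_real (closure \<Omega>) \<in> H1 \<Omega>"
    "AE x in lebesgue_on \<Omega>. weak_grad \<Omega> (indicat_real (closure \<Omega>)) x = 0"
proof -
  have L2: "indicat_real (closure \<Omega>) \<in> L2 \<Omega>"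
  proof (rule continuous_on_closure_in_L2[OF \<Omega>])
    have "continuous_on (closure \<Omega>) (\<lambda>_. 1 :: real)" by (rule continuous_on_const)
    then show "continuous_on (closure \<Omega>) (indicat_real (closure \<Omega>))"
      by (rule continuous_on_eq) simp
  qed
  have zero: "(\<lambda>_. 0) \<in> L2 \<Omega>" by (simp add: L2_def)
  have "is_weak_grad \<Omega> (indicat_real (closure \<Omega>)) (\<lambda>_. 0)"
    unfolding is_weak_grad_def
  proof (intro ballI allI)
    fix \<phi> i assume \<phi>: "\<phi> \<in> test_functions \<Omega>"
    have "integ \<Omega> (\<lambda>x. indicat_real (closure \<Omega>) x * partial_deriv i \<phi> x) = integ \<Omega> (partial_deriv i \<phi>)"
      unfolding integ_def
    proof (rule Bochner_Integration.integral_cong[OF refl])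
      fix x assume "x \<in> space (lebesgue_on \<Omega>)"
      then have "x \<in> closure \<Omega>" using closure_subset[of \<Omega>] by auto
      then show "indicat_real (closure \<Omega>) x * partial_deriv i \<phi> x = partial_deriv i \<phi> x" by simp
    qed
    also have "\<dots> = 0" by (rule integ_partial_deriv_test_function[OF \<Omega>(1) \<phi>])
    finally show "integ \<Omega> (\<lambda>x. indicat_real (closure \<Omega>) x * partial_deriv i \<phi> x) = - integ \<Omega> (\<lambda>x. 0 $ i * \<phi> x)"
      by (simp add: integ_def)
  qed
  from weak_grad_eq_AE[OF \<Omega> L2 zero this]
  show "indicat_real (closure \<Omega>) \<in> H1 \<Omega>"
    "AE x in lebesgue_on \<Omega>. weak_grad \<Omega> (indicat_real (closure \<Omega>)) x = 0" .
qed

lemma A_form_integrable: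
  assumes a: "a \<in> borel_measurable (lebesgue_on \<Omega>)" "\<And>x. x \<in> \<Omega> \<Longrightarrow> \<bar>a x\<bar> \<le> C"
    and qv: "q \<in> H1 \<Omega>" "v \<in> H1 \<Omega>"
  shows "integrable (lebesgue_on \<Omega>) (\<lambda>x. a x * (weak_grad \<Omega> q x \<bullet> weak_grad \<Omega> v x))"
proof (rule Bochner_Integration.integrable_bound)
  note g = weak_grad_H1(1)[OF qv(1)] weak_grad_H1(1)[OF qv(2)]
  show "integrable (lebesgue_on \<Omega>) (\<lambda>x. C * (weak_grad \<Omega> q x \<bullet> weak_grad \<Omega> v x))"
    by (intro integrable_mult_right L2_inner_integrable g)
  show "(\<lambda>x. a x * (weak_grad \<Omega> q x \<bullet> weak_grad \<Omega> v x)) \<in> borel_measurable (lebesgue_on \<Omega>)"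
    by (intro borel_measurable_times borel_measurable_inner a(1) L2_measurable g)
  show "AE x in lebesgue_on \<Omega>. norm (a x * (weak_grad \<Omega> q x \<bullet> weak_grad \<Omega> v x))
      \<le> norm (C * (weak_grad \<Omega> q x \<bullet> weak_grad \<Omega> v x))"
  proof (rule AE_I2)
    fix x assume "x \<in> space (lebesgue_on \<Omega>)"
    then have "\<bar>a x\<bar> \<le> \<bar>C\<bar>" using a(2)[of x] by simp
    then show "norm (a x * (weak_grad \<Omega> q x \<bullet> weak_grad \<Omega> v x)) \<le> norm (C * (weak_grad \<Omega> q x \<bullet> weak_grad \<Omega> v x))"
      by (simp add: abs_mult mult_right_mono)
  qed
qed

text \<open>
  The integral only sees the gradient up to null sets; together with \<open>H1_add\<close> and \<open>H1_scale\<close> this is the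
  source of bilinearity.
\<close>

lemma A_form_cong_AE:
  fixes a :: "real^'d::finite \<Rightarrow> real"
  assumes a: "a \<in> borel_measurable (lebesgue_on \<Omega>)"
    and q: "q \<in> H1 \<Omega>" and v: "v \<in> H1 \<Omega>" and g: "g \<in> L2 \<Omega>"
    and AE: "AE x in lebesgue_on \<Omega>. weak_grad \<Omega> q x = g x"
  shows "A_form \<Omega> a q v = integ \<Omega> (\<lambda>x. a x * (g x \<bullet> weak_grad \<Omega> v x))"
  unfolding A_form_def integ_def
proof (rule integral_cong_AE)
  show "(\<lambda>x. a x * (weak_grad \<Omega> q x \<bullet> weak_grad \<Omega> v x)) \<in> borel_measurable (lebesgue_on \<Omega>)"
    by (intro borel_measurable_times borel_measurable_inner a L2_measurable weak_grad_H1 q v)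
  show "(\<lambda>x. a x * (g x \<bullet> weak_grad \<Omega> v x)) \<in> borel_measurable (lebesgue_on \<Omega>)"
    by (intro borel_measurable_times borel_measurable_inner a L2_measurable weak_grad_H1 g v)
  show "AE x in lebesgue_on \<Omega>. a x * (weak_grad \<Omega> q x \<bullet> weak_grad \<Omega> v x) = a x * (g x \<bullet> weak_grad \<Omega> v x)"
    using AE by eventually_elim simp
qed

lemma A_form_sym: "A_form \<Omega> a q v = A_form \<Omega> a v q"
  unfolding A_form_def by (simp add: inner_commute)

lemma psd_form_on_A_form:
  fixes \<Omega> :: "(real^'d::finite) set"
  assumes \<Omega>: "open \<Omega>" "bounded \<Omega>" and V: "V \<subseteq> H1 \<Omega>"
    and a: "continuous_on (closure \<Omega>) a" "\<And>x. x \<in> \<Omega> \<Longrightarrow> 0 \<le> a x"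
  shows "psd_form_on V (A_form \<Omega> a)"
proof -
  obtain C where am: "a \<in> borel_measurable (lebesgue_on \<Omega>)" and C: "\<And>x. x \<in> \<Omega> \<Longrightarrow> \<bar>a x\<bar> \<le> C"
    using continuous_on_closure_bounded_measurable[OF \<Omega> a(1)] by blast
  note int = A_form_integrable[OF am C]
  have lin: "linear_form_on V (\<lambda>q. A_form \<Omega> a q v)" if v: "v \<in> V" for v
    unfolding linear_form_on_def
  proof (intro conjI ballI allI)
    have vH: "v \<in> H1 \<Omega>" using v V by blast
    note gv = weak_grad_H1(1)[OF vH]
    fix q q' :: "real^'d \<Rightarrow> real" assume "q \<in> V" "q' \<in> V"
    then have H: "q \<in> H1 \<Omega>" "q' \<in> H1 \<Omega>" using V by auto
    have "A_form \<Omega> a (q + q') v = integ \<Omega> (\<lambda>x. a x * ((weak_grad \<Omega> q x + weak_grad \<Omega> q' x) \<bullet> weak_grad \<Omega> v x))"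
      by (rule A_form_cong_AE[OF am H1_add(1)[OF \<Omega> H] vH L2_add H1_add(2)[OF \<Omega> H]])
         (intro weak_grad_H1 H)+
    also have "\<dots> = A_form \<Omega> a q v + A_form \<Omega> a q' v"
      unfolding A_form_def integ_def inner_add_left distrib_left
      by (rule Bochner_Integration.integral_add) (rule int H vH, assumption?)+
    finally show "A_form \<Omega> a (q + q') v = A_form \<Omega> a q v + A_form \<Omega> a q' v" .
  next
    have vH: "v \<in> H1 \<Omega>" using v V by blast
    fix c :: real and q assume "q \<in> V"
    then have H: "q \<in> H1 \<Omega>" using V by auto
    have "A_form \<Omega> a (c *\<^sub>R q) v = integ \<Omega> (\<lambda>x. a x * ((c *\<^sub>R weak_grad \<Omega> q x) \<bullet> weak_grad \<Omega> v x))"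
      by (rule A_form_cong_AE[OF am H1_scale(1)[OF \<Omega> H] vH L2_scale H1_scale(2)[OF \<Omega> H]])
         (rule weak_grad_H1 H)+
    also have "\<dots> = c * A_form \<Omega> a q v"
      unfolding A_form_def integ_def by (simp add: mult.left_commute)
    finally show "A_form \<Omega> a (c *\<^sub>R q) v = c * A_form \<Omega> a q v" .
  qed
  show ?thesis
  proof (rule psd_form_onI)
    show "linear_form_on V (A_form \<Omega> a v)" if "v \<in> V" for v
      using lin[OF that] by (simp only: A_form_sym[of _ _ _ v])
    show "0 \<le> A_form \<Omega> a q q" for q
      unfolding A_form_def integ_def
      by (intro integral_nonneg_AE AE_I2 mult_nonneg_nonneg inner_ge_zero a(2)) simp
  qed (rule A_form_sym)
qed

lemma A_form_constant:
  fixes \<Omega> :: "(real^'d::finite) set"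
  assumes \<Omega>: "open \<Omega>" "bounded \<Omega>" and a: "continuous_on (closure \<Omega>) a" and v: "v \<in> H1 \<Omega>"
  shows "A_form \<Omega> a v (indicat_real (closure \<Omega>)) = 0"
proof -
  obtain C where am: "a \<in> borel_measurable (lebesgue_on \<Omega>)"
    using continuous_on_closure_bounded_measurable[OF \<Omega> a] by blast
  have "A_form \<Omega> a (indicat_real (closure \<Omega>)) v = integ \<Omega> (\<lambda>x. a x * (0 \<bullet> weak_grad \<Omega> v x))"
    by (rule A_form_cong_AE[OF am constant_in_H1(1)[OF \<Omega>] v _ constant_in_H1(2)[OF \<Omega>]]) (simp add: L2_def)
  then show ?thesis by (simp add: A_form_sym[of \<Omega> a v] integ_def)
qed

section \<open>The finite element space\<close>

lemma C0_subspace: "subspace (C0 \<Omega>)"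
  unfolding subspace_def C0_def
proof (intro conjI ballI allI CollectI)
  fix u v :: "'a \<Rightarrow> real" and c :: real
  assume u: "u \<in> {v. continuous_on (closure \<Omega>) v \<and> (\<forall>x. x \<notin> closure \<Omega> \<longrightarrow> v x = 0)}"
  then show "continuous_on (closure \<Omega>) (c *\<^sub>R u)" "x \<notin> closure \<Omega> \<longrightarrow> (c *\<^sub>R u) x = 0" for x
    unfolding scaleR_fun_def by (auto intro: continuous_on_mult continuous_on_const)
  assume "v \<in> {v. continuous_on (closure \<Omega>) v \<and> (\<forall>x. x \<notin> closure \<Omega> \<longrightarrow> v x = 0)}"
  with u show "continuous_on (closure \<Omega>) (u + v)" "x \<notin> closure \<Omega> \<longrightarrow> (u + v) x = 0" for x
    unfolding plus_fun_def by (auto intro: continuous_on_add)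
qed (simp_all add: zero_fun_def)

lemma finite_multi_indices: "finite {\<alpha> :: 'd::finite \<Rightarrow> nat. (\<Sum>i\<in>UNIV. \<alpha> i) \<le> k}"
proof (rule finite_subset)
  show "{\<alpha> :: 'd \<Rightarrow> nat. (\<Sum>i\<in>UNIV. \<alpha> i) \<le> k} \<subseteq> PiE UNIV (\<lambda>_. {..k})"
  proof
    fix \<alpha> :: "'d \<Rightarrow> nat" assume "\<alpha> \<in> {\<alpha>. (\<Sum>i\<in>UNIV. \<alpha> i) \<le> k}"
    moreover have "\<alpha> i \<le> (\<Sum>i\<in>UNIV. \<alpha> i)" for i by (rule member_le_sum) auto
    ultimately show "\<alpha> \<in> PiE UNIV (\<lambda>_. {..k})" by (auto intro: order_trans)
  qed
qed (intro finite_PiE; simp)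

lemma Pk_add: "p \<in> Pk k \<Longrightarrow> q \<in> Pk k \<Longrightarrow> p + q \<in> Pk k"
proof -
  assume "p \<in> Pk k" "q \<in> Pk k"
  then obtain c d where "\<And>x. p x = (\<Sum>\<alpha>\<in>{\<alpha>. (\<Sum>i\<in>UNIV. \<alpha> i) \<le> k}. c \<alpha> * (\<Prod>i\<in>UNIV. (x $ i) ^ \<alpha> i))"
    "\<And>x. q x = (\<Sum>\<alpha>\<in>{\<alpha>. (\<Sum>i\<in>UNIV. \<alpha> i) \<le> k}. d \<alpha> * (\<Prod>i\<in>UNIV. (x $ i) ^ \<alpha> i))"
    unfolding Pk_def by blast
  then show "p + q \<in> Pk k"
    unfolding Pk_def by (intro CollectI exI[of _ "\<lambda>\<alpha>. c \<alpha> + d \<alpha>"]) (simp add: distrib_right sum.distrib)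
qed

lemma Pk_scale: "p \<in> Pk k \<Longrightarrow> r *\<^sub>R p \<in> Pk k"
proof -
  assume "p \<in> Pk k"
  then obtain c where "\<And>x. p x = (\<Sum>\<alpha>\<in>{\<alpha>. (\<Sum>i\<in>UNIV. \<alpha> i) \<le> k}. c \<alpha> * (\<Prod>i\<in>UNIV. (x $ i) ^ \<alpha> i))"
    unfolding Pk_def by blast
  then show "r *\<^sub>R p \<in> Pk k"
    unfolding Pk_def by (intro CollectI exI[of _ "\<lambda>\<alpha>. r * c \<alpha>"]) (simp add: sum_distrib_left mult.assoc)
qed

lemma Pk_one: "(\<lambda>_. 1) \<in> (Pk k :: (real^'d::finite \<Rightarrow> real) set)"
proof -
  define A where "A = {\<alpha> :: 'd \<Rightarrow> nat. (\<Sum>i\<in>UNIV. \<alpha> i) \<le> k}"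
  have fin: "finite A" unfolding A_def by (rule finite_multi_indices)
  have zero: "(\<lambda>_. 0) \<in> A" unfolding A_def by simp
  have "(\<Sum>\<alpha>\<in>A. (if \<alpha> = (\<lambda>_. 0) then 1 else 0) * (\<Prod>i\<in>UNIV. (x $ i) ^ \<alpha> i)) = 1" for x :: "real^'d"
  proof -
    have "(\<Sum>\<alpha>\<in>A. (if \<alpha> = (\<lambda>_. 0) then 1 else 0) * (\<Prod>i\<in>UNIV. (x $ i) ^ \<alpha> i))
        = (\<Sum>\<alpha>\<in>A. if \<alpha> = (\<lambda>_. 0) then 1 else 0)"
      by (rule sum.cong) auto
    then show ?thesis using fin zero by (simp add: sum.delta)
  qed
  then show ?thesis unfolding Pk_def A_def
    by (intro CollectI exI[of _ "\<lambda>\<alpha>. if \<alpha> = (\<lambda>_. 0) then 1 else 0"]) simp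
qed

lemma VhI:
  assumes "v \<in> C0 \<Omega>" "v \<in> H1 \<Omega>" "\<And>T. T \<in> \<T> \<Longrightarrow> \<exists>p\<in>Pk k. \<forall>x\<in>T. v x = p x"
  shows "v \<in> Vh k \<T> \<Omega>"
  unfolding Vh_def using assms by simp

lemma VhD:
  assumes "v \<in> Vh k \<T> \<Omega>"
  shows "v \<in> C0 \<Omega>" "v \<in> H1 \<Omega>" "T \<in> \<T> \<Longrightarrow> \<exists>p\<in>Pk k. \<forall>x\<in>T. v x = p x"
  using assms unfolding Vh_def by simp_all

lemma constant_in_Vh:
  assumes \<Omega>: "open \<Omega>" "bounded \<Omega>" and cover: "\<Union>\<T> = closure \<Omega>"
  shows "indicat_real (closure \<Omega>) \<in> Vh k \<T> \<Omega>"
proof -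
  have "continuous_on (closure \<Omega>) (\<lambda>_. 1 :: real)" by (rule continuous_on_const)
  then have "continuous_on (closure \<Omega>) (indicat_real (closure \<Omega>))"
    by (rule continuous_on_eq) simp
  then have "indicat_real (closure \<Omega>) \<in> C0 \<Omega>" unfolding C0_def by simp
  moreover have "\<forall>T\<in>\<T>. \<exists>p\<in>Pk k. \<forall>x\<in>T. indicat_real (closure \<Omega>) x = p x"
    by (intro ballI bexI[OF _ Pk_one]) (use cover in \<open>auto simp: indicator_def\<close>)
  ultimately show ?thesis
    unfolding Vh_def using constant_in_H1(1)[OF \<Omega>] by simp
qed

lemma Vh_subspace:
  assumes \<Omega>: "open \<Omega>" "bounded \<Omega>" and cover: "\<Union>\<T> = closure \<Omega>"
  shows "subspace (Vh k \<T> \<Omega>)"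
proof -
  have add: "u + v \<in> Vh k \<T> \<Omega>" if u: "u \<in> Vh k \<T> \<Omega>" and v: "v \<in> Vh k \<T> \<Omega>" for u v
  proof (rule VhI)
    show "u + v \<in> C0 \<Omega>" by (rule subspace_add[OF C0_subspace VhD(1)[OF u] VhD(1)[OF v]])
    show "u + v \<in> H1 \<Omega>" by (rule H1_add(1)[OF \<Omega> VhD(2)[OF u] VhD(2)[OF v]])
    fix T assume T: "T \<in> \<T>"
    obtain p q where "p \<in> Pk k" "\<forall>x\<in>T. u x = p x" "q \<in> Pk k" "\<forall>x\<in>T. v x = q x"
      using VhD(3)[OF u T] VhD(3)[OF v T] by blast
    then show "\<exists>p\<in>Pk k. \<forall>x\<in>T. (u + v) x = p x" by (intro bexI[of _ "p + q"] Pk_add) auto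
  qed
  have scale: "c *\<^sub>R u \<in> Vh k \<T> \<Omega>" if u: "u \<in> Vh k \<T> \<Omega>" for c u
  proof (rule VhI)
    show "c *\<^sub>R u \<in> C0 \<Omega>" by (rule subspace_scale[OF C0_subspace VhD(1)[OF u]])
    show "c *\<^sub>R u \<in> H1 \<Omega>" by (rule H1_scale(1)[OF \<Omega> VhD(2)[OF u]])
    fix T assume T: "T \<in> \<T>"
    obtain p where "p \<in> Pk k" "\<forall>x\<in>T. u x = p x" using VhD(3)[OF u T] by blast
    then show "\<exists>p\<in>Pk k. \<forall>x\<in>T. (c *\<^sub>R u) x = p x" by (intro bexI[of _ "c *\<^sub>R p"] Pk_scale) auto
  qed
  have "0 *\<^sub>R indicat_real (closure \<Omega>) \<in> Vh k \<T> \<Omega>"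
    by (rule scale[OF constant_in_Vh[OF assms]])
  then show ?thesis unfolding subspace_def using add scale by simp
qed

lemma sum_fun_eval: "(\<Sum>i\<in>A. f i) x = (\<Sum>i\<in>A. f i x)"
  for f :: "'i \<Rightarrow> 'a \<Rightarrow> 'b::comm_monoid_add"
  by (induction A rule: infinite_finite_induct) auto

text \<open>
  Assign to each point of \<open>closure \<Omega>\<close> one element \<open>\<tau> x\<close> that contains it. A piecewise polynomial is then a
  combination of monomials cut off to the cells of \<open>\<tau>\<close>. The generators are discontinuous and lie
  outside the finite element space, but their span contains it.
\<close>

lemma Vh_finite_dim:
  fixes \<Omega> :: "(real^'d::finite) set"
  assumes fin: "finite \<T>" and cover: "\<Union>\<T> = closure \<Omega>"
  shows "\<exists>G. finite G \<and> Vh k \<T> \<Omega> \<subseteq> span G"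
proof -
  define A where "A = {\<alpha> :: 'd \<Rightarrow> nat. (\<Sum>i\<in>UNIV. \<alpha> i) \<le> k}"
  have finA: "finite A" unfolding A_def by (rule finite_multi_indices)
  have "\<forall>x\<in>closure \<Omega>. \<exists>T. T \<in> \<T> \<and> x \<in> T" using cover by blast
  from bchoice[OF this] obtain \<tau> where \<tau>: "\<And>x. x \<in> closure \<Omega> \<Longrightarrow> \<tau> x \<in> \<T> \<and> x \<in> \<tau> x" by blast
  define g where "g T \<alpha> x = (if x \<in> closure \<Omega> \<and> \<tau> x = T then \<Prod>i\<in>UNIV. (x $ i) ^ \<alpha> i else 0)" for T \<alpha> x
  define G where "G = case_prod g ` (\<T> \<times> A)"
  have "v \<in> span G" if v: "v \<in> Vh k \<T> \<Omega>" for v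
  proof -
    have "\<forall>T\<in>\<T>. \<exists>c. \<forall>x\<in>T. v x = (\<Sum>\<alpha>\<in>A. c \<alpha> * (\<Prod>i\<in>UNIV. (x $ i) ^ \<alpha> i))"
      using v unfolding Vh_def Pk_def A_def by fastforce
    from bchoice[OF this] obtain c
      where c: "\<And>T x. T \<in> \<T> \<Longrightarrow> x \<in> T \<Longrightarrow> v x = (\<Sum>\<alpha>\<in>A. c T \<alpha> * (\<Prod>i\<in>UNIV. (x $ i) ^ \<alpha> i))" by blast
    have "v = (\<Sum>T\<in>\<T>. \<Sum>\<alpha>\<in>A. c T \<alpha> *\<^sub>R g T \<alpha>)"
    proof
      fix x
      have "(\<Sum>T\<in>\<T>. \<Sum>\<alpha>\<in>A. c T \<alpha> *\<^sub>R g T \<alpha>) x = (\<Sum>T\<in>\<T>. \<Sum>\<alpha>\<in>A. c T \<alpha> * g T \<alpha> x)"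
        by (simp add: sum_fun_eval)
      also have "\<dots> = v x"
      proof (cases "x \<in> closure \<Omega>")
        case True
        have "(\<Sum>\<alpha>\<in>A. c T \<alpha> * g T \<alpha> x) = (if T = \<tau> x then v x else 0)" if "T \<in> \<T>" for T
          using True c[OF that, of x] \<tau>[OF True] by (auto simp: g_def)
        then have "(\<Sum>T\<in>\<T>. \<Sum>\<alpha>\<in>A. c T \<alpha> * g T \<alpha> x) = (\<Sum>T\<in>\<T>. if T = \<tau> x then v x else 0)"
          by (intro sum.cong) auto
        then show ?thesis using fin \<tau>[OF True] by simp
      next
        case False
        then show ?thesis using v by (simp add: g_def Vh_def C0_def)
      qed
      finally show "v x = (\<Sum>T\<in>\<T>. \<Sum>\<alpha>\<in>A. c T \<alpha> *\<^sub>R g T \<alpha>) x" by simp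
    qed
    moreover have "(\<Sum>T\<in>\<T>. \<Sum>\<alpha>\<in>A. c T \<alpha> *\<^sub>R g T \<alpha>) \<in> span G"
    proof (intro span_sum span_scale span_base)
      fix T \<alpha> assume "T \<in> \<T>" "\<alpha> \<in> A"
      then have "case_prod g (T, \<alpha>) \<in> G" unfolding G_def by (intro imageI) auto
      then show "g T \<alpha> \<in> G" by simp
    qed
    ultimately show ?thesis by simp
  qed
  moreover have "finite G" unfolding G_def using fin finA by simp
  ultimately show ?thesis by blast
qed

section \<open>The \<open>L\<^sup>2\<close> structure of a Galerkin space\<close>

lemma linear_form_on_combination:
  assumes "linear_form_on V f" "linear_form_on V g"
  shows "linear_form_on V (\<lambda>x. f x + c * g x)"
  using assms unfolding linear_form_on_def by (simp add: distrib_left mult.left_commute)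

lemma psd_form_on_combination:
  assumes a: "psd_form_on V a" and b: "psd_form_on V b" and c: "0 \<le> c"
  shows "psd_form_on V (\<lambda>x y. a x y + c * b x y)"
  unfolding psd_form_on_def bilinear_form_on_def
proof (intro conjI ballI)
  fix x assume x: "x \<in> V"
  show "linear_form_on V (\<lambda>y. a x y + c * b x y)" "linear_form_on V (\<lambda>y. a y x + c * b y x)"
    using psd_form_onD(1)[OF a] psd_form_onD(1)[OF b] x unfolding bilinear_form_on_def
    by (auto intro: linear_form_on_combination)
  show "0 \<le> a x x + c * b x x"
    using psd_form_onD(3)[OF a x] psd_form_onD(3)[OF b x] c by simp
  fix y assume y: "y \<in> V"
  show "a x y + c * b x y = a y x + c * b y x"
    using psd_form_onD(2)[OF a x y] psd_form_onD(2)[OF b x y] by simp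
qed

lemma linear_form_on_L2_inner:
  assumes f: "f \<in> L2 \<Omega>" and V: "V \<subseteq> L2 \<Omega>"
  shows "linear_form_on V (L2_inner \<Omega> f)"
  unfolding linear_form_on_def
proof (intro conjI ballI allI)
  fix x y assume "x \<in> V" "y \<in> V"
  then have "x \<in> L2 \<Omega>" "y \<in> L2 \<Omega>" using V by auto
  then show "L2_inner \<Omega> f (x + y) = L2_inner \<Omega> f x + L2_inner \<Omega> f y"
    unfolding L2_inner_def integ_def plus_fun_apply distrib_left
    by (intro Bochner_Integration.integral_add L2_mult_integrable f)
next
  fix c x
  show "L2_inner \<Omega> f (c *\<^sub>R x) = c * L2_inner \<Omega> f x"
    unfolding L2_inner_def integ_def by (simp add: mult.left_commute)
qed

lemma L2_continuous_mult:
  fixes a f :: "'a::euclidean_space \<Rightarrow> real"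
  assumes \<Omega>: "open \<Omega>" "bounded \<Omega>" and a: "continuous_on (closure \<Omega>) a" and f: "f \<in> L2 \<Omega>"
  shows "(\<lambda>x. a x * f x) \<in> L2 \<Omega>"
proof -
  obtain C where am: "a \<in> borel_measurable (lebesgue_on \<Omega>)" and C: "\<And>x. x \<in> \<Omega> \<Longrightarrow> \<bar>a x\<bar> \<le> C"
    using continuous_on_closure_bounded_measurable[OF \<Omega> a] by blast
  have m: "(\<lambda>x. a x * f x) \<in> borel_measurable (lebesgue_on \<Omega>)"
    by (intro borel_measurable_times am L2_measurable f)
  have "integrable (lebesgue_on \<Omega>) (\<lambda>x. (norm (a x * f x))\<^sup>2)"
  proof (rule Bochner_Integration.integrable_bound)
    show "integrable (lebesgue_on \<Omega>) (\<lambda>x. C\<^sup>2 * (norm (f x))\<^sup>2)"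
      by (intro integrable_mult_right L2_square_integrable f)
    show "(\<lambda>x. (norm (a x * f x))\<^sup>2) \<in> borel_measurable (lebesgue_on \<Omega>)"
      using m by simp
    show "AE x in lebesgue_on \<Omega>. norm ((norm (a x * f x))\<^sup>2) \<le> norm (C\<^sup>2 * (norm (f x))\<^sup>2)"
    proof (rule AE_I2)
      fix x assume "x \<in> space (lebesgue_on \<Omega>)"
      then have "\<bar>a x\<bar> \<le> C" using C by simp
      then have "(a x)\<^sup>2 \<le> C\<^sup>2" by (metis abs_ge_zero power2_abs power_mono)
      then show "norm ((norm (a x * f x))\<^sup>2) \<le> norm (C\<^sup>2 * (norm (f x))\<^sup>2)"
        by (simp add: power_mult_distrib abs_mult mult_right_mono)
    qed
  qed
  then show ?thesis using m unfolding L2_def by simp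
qed

lemma psd_form_on_weighted_L2:
  fixes \<Omega> :: "'a::euclidean_space set"
  assumes \<Omega>: "open \<Omega>" "bounded \<Omega>" and V: "V \<subseteq> L2 \<Omega>"
    and a: "continuous_on (closure \<Omega>) a" "\<And>x. x \<in> \<Omega> \<Longrightarrow> 0 \<le> a x"
  shows "psd_form_on V (\<lambda>f g. L2_inner \<Omega> (\<lambda>x. a x * f x) g)"
proof -
  have sym: "L2_inner \<Omega> (\<lambda>x. a x * f x) g = L2_inner \<Omega> (\<lambda>x. a x * g x) f" for f g
    unfolding L2_inner_def by (simp add: mult_ac)
  have lin: "linear_form_on V (L2_inner \<Omega> (\<lambda>x. a x * f x))" if "f \<in> V" for f
    by (rule linear_form_on_L2_inner[OF L2_continuous_mult[OF \<Omega> a(1)] V]) (use that V in blast)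
  show ?thesis
  proof (rule psd_form_onI)
    show "0 \<le> L2_inner \<Omega> (\<lambda>x. a x * f x) f" for f
      unfolding L2_inner_def integ_def mult.assoc
      by (intro integral_nonneg_AE AE_I2 mult_nonneg_nonneg a(2) zero_le_square) simp
  qed (fact lin, fact sym)
qed

lemma L2_inner_sym: "L2_inner \<Omega> f g = L2_inner \<Omega> g f"
  unfolding L2_inner_def by (simp add: mult.commute)

text \<open>
  A continuous function that is zero almost everywhere on an open set is zero there, since nonempty open
  sets are not negligible; continuity extends this to the closure, and outside it the function is zero
  by convention.
\<close>

lemma L2_inner_self_eq_0_imp:
  fixes \<Omega> :: "'a::euclidean_space set"
  assumes \<Omega>: "open \<Omega>" "bounded \<Omega>" and v: "v \<in> C0 \<Omega>" and zero: "L2_inner \<Omega> v v = 0"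
  shows "v = 0"
proof -
  have cont: "continuous_on (closure \<Omega>) v" and out: "\<And>x. x \<notin> closure \<Omega> \<Longrightarrow> v x = 0"
    using v unfolding C0_def by auto
  have L2: "v \<in> L2 \<Omega>" by (rule continuous_on_closure_in_L2[OF \<Omega> cont])
  have meas: "\<Omega> \<in> sets lebesgue" using \<Omega> by (simp add: lebesgue_openin)
  have "AE x in lebesgue_on \<Omega>. v x * v x = 0"
    using integral_nonneg_eq_0_iff_AE[OF L2_mult_integrable[OF L2 L2]] zero
    unfolding L2_inner_def integ_def by simp
  then have "AE x in lebesgue. x \<in> \<Omega> \<longrightarrow> v x * v x = 0"
    using AE_restrict_space_iff[of \<Omega> lebesgue] meas by simp
  then have "AE x in lebesgue. x \<notin> {x\<in>\<Omega>. v x \<noteq> 0}"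
    by eventually_elim auto
  moreover have op: "open {x\<in>\<Omega>. v x \<noteq> 0}"
  proof -
    have "open (\<Omega> \<inter> v -` (- {0}))"
      by (rule continuous_open_preimage[OF continuous_on_subset[OF cont closure_subset] \<Omega>(1)])
         (simp add: open_Compl)
    moreover have "\<Omega> \<inter> v -` (- {0}) = {x\<in>\<Omega>. v x \<noteq> 0}" by auto
    ultimately show ?thesis by simp
  qed
  moreover have "{x\<in>\<Omega>. v x \<noteq> 0} \<in> sets lebesgue" using op by (simp add: lebesgue_openin)
  ultimately have "negligible {x\<in>\<Omega>. v x \<noteq> 0}"
    using AE_iff_null_sets negligible_iff_null_sets by blast
  then have "{x\<in>\<Omega>. v x \<noteq> 0} = {}" using op open_not_negligible by blast
  then have "\<And>x. x \<in> \<Omega> \<Longrightarrow> v x = 0" by blast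
  then have "\<And>x. x \<in> closure \<Omega> \<Longrightarrow> v x = 0"
    by (rule continuous_constant_on_closure[OF cont])
  then have "v x = 0" for x using out[of x] by (cases "x \<in> closure \<Omega>") simp_all
  then show ?thesis by (simp add: fun_eq_iff)
qed

text \<open>
  The properties of the finite element space on which the scheme relies; polynomials and meshes enter
  only through them.
\<close>

locale galerkin_space =
  fixes \<Omega> :: "(real^'d::finite) set" and V :: "(real^'d \<Rightarrow> real) set"
  assumes \<Omega>: "open \<Omega>" "bounded \<Omega>"
    and subspace_V: "subspace V"
    and fin_dim: "\<exists>G. finite G \<and> V \<subseteq> span G"
    and V_C0: "V \<subseteq> C0 \<Omega>" and V_H1: "V \<subseteq> H1 \<Omega>"
    and const_V: "indicat_real (closure \<Omega>) \<in> V"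
begin

lemma V_L2: "V \<subseteq> L2 \<Omega>"
  using V_H1 H1_imp_L2 by blast

lemma C0_L2: "U \<in> C0 \<Omega> \<Longrightarrow> U \<in> L2 \<Omega>"
  unfolding C0_def using continuous_on_closure_in_L2[OF \<Omega>] by blast

lemma inner_product_on_V: "inner_product_on V (L2_inner \<Omega>)"
proof -
  have "psd_form_on V (\<lambda>f g. L2_inner \<Omega> (\<lambda>x. 1 * f x) g)"
    by (rule psd_form_on_weighted_L2[OF \<Omega> V_L2 continuous_on_const]) simp
  then show ?thesis
    unfolding inner_product_on_def using L2_inner_self_eq_0_imp[OF \<Omega>] V_C0 by (simp add: subset_iff)
qed

lemma L2_inner_diff_left:
  assumes "f \<in> L2 \<Omega>" "g \<in> L2 \<Omega>" "h \<in> L2 \<Omega>"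
  shows "L2_inner \<Omega> (\<lambda>x. f x - g x) h = L2_inner \<Omega> f h - L2_inner \<Omega> g h"
  unfolding L2_inner_def integ_def left_diff_distrib
  by (intro Bochner_Integration.integral_diff L2_mult_integrable assms)

lemma L2_proj:
  assumes f: "f \<in> L2 \<Omega>"
  shows "L2_proj \<Omega> V f \<in> V"
    and "\<And>\<phi>. \<phi> \<in> V \<Longrightarrow> L2_inner \<Omega> (L2_proj \<Omega> V f) \<phi> = L2_inner \<Omega> f \<phi>"
proof -
  let ?P = "\<lambda>p. p \<in> V \<and> (\<forall>\<phi>\<in>V. L2_inner \<Omega> (\<lambda>x. f x - p x) \<phi> = 0)"
  have iff: "?P p \<longleftrightarrow> p \<in> V \<and> (\<forall>\<phi>\<in>V. L2_inner \<Omega> p \<phi> = L2_inner \<Omega> f \<phi>)" for p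
    using L2_inner_diff_left[OF f] V_L2 by (auto simp: subset_iff)
  obtain G where G: "finite G" "V \<subseteq> span G" using fin_dim by blast
  obtain p where p: "p \<in> V" "\<forall>\<phi>\<in>V. L2_inner \<Omega> p \<phi> = L2_inner \<Omega> f \<phi>"
    using finite_dim_riesz[OF subspace_V G inner_product_on_V linear_form_on_L2_inner[OF f V_L2]] by blast
  have "\<exists>!p. ?P p"
  proof (rule ex1I[of _ p])
    show "?P p" using p iff by blast
    fix q assume "?P q"
    then have q: "q \<in> V" "\<forall>\<phi>\<in>V. L2_inner \<Omega> q \<phi> = L2_inner \<Omega> f \<phi>" using iff by blast+
    show "q = p"
      by (rule inner_product_on_eqI[OF inner_product_on_V subspace_V q(1) p(1)]) (use p q in simp)
  qed
  from theI'[OF this] have "?P (L2_proj \<Omega> V f)" unfolding L2_proj_def .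
  then show "L2_proj \<Omega> V f \<in> V" "\<And>\<phi>. \<phi> \<in> V \<Longrightarrow> L2_inner \<Omega> (L2_proj \<Omega> V f) \<phi> = L2_inner \<Omega> f \<phi>"
    using iff by blast+
qed

text \<open>
  Pythagoras: the defect \<open>f - p\<close> is orthogonal to \<open>p\<close>, so \<open>(f, f) - (p, p)\<close> is its squared norm.
\<close>

lemma L2_inner_self_proj_le:
  assumes f: "f \<in> L2 \<Omega>"
  shows "L2_inner \<Omega> (L2_proj \<Omega> V f) (L2_proj \<Omega> V f) \<le> L2_inner \<Omega> f f"
proof -
  define p where "p = L2_proj \<Omega> V f"
  have p: "p \<in> V" "L2_inner \<Omega> p p = L2_inner \<Omega> f p" using L2_proj[OF f] unfolding p_def by auto
  have pL: "p \<in> L2 \<Omega>" using p V_L2 by blast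
  have dL: "(\<lambda>x. f x - p x) \<in> L2 \<Omega>"
    using L2_add[OF f L2_scale[OF pL, of "-1"]] by simp
  have "0 \<le> L2_inner \<Omega> (\<lambda>x. f x - p x) (\<lambda>x. f x - p x)"
    unfolding L2_inner_def integ_def by (rule integral_nonneg_AE) simp
  also have "\<dots> = L2_inner \<Omega> f (\<lambda>x. f x - p x) - L2_inner \<Omega> p (\<lambda>x. f x - p x)"
    by (rule L2_inner_diff_left[OF f pL dL])
  also have "\<dots> = L2_inner \<Omega> f f - L2_inner \<Omega> p p"
    unfolding L2_inner_sym[of _ _ "\<lambda>x. f x - p x"]
    using p(2) by (simp add: L2_inner_diff_left f pL L2_inner_sym[of \<Omega> p f])
  finally show ?thesis unfolding p_def by simp
qed

lemma energy_proj_le: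
  assumes "U \<in> C0 \<Omega>"
  shows "energy \<Omega> \<epsilon> B u (L2_proj \<Omega> V U) \<le> energy \<Omega> \<epsilon> B u U"
  using L2_inner_self_proj_le[OF C0_L2[OF assms]]
  unfolding energy_def L2_inner_def by (simp add: power2_eq_square)

end

section \<open>One step of the scheme\<close>

text \<open>
  The time step is carried out from \<open>(v, Y)\<close>. The composite coefficients are assumed continuous on the
  closed domain, where they are then bounded.
\<close>

locale scheme_data = galerkin_space \<Omega> V for \<Omega> :: "(real^'d::finite) set" and V +
  fixes \<epsilon> B dt :: real and F F' M :: "real \<Rightarrow> real" and v Y :: "real^'d \<Rightarrow> real"
  assumes dt: "0 < dt"
    and H_continuous: "continuous_on (closure \<Omega>) (\<lambda>x. Hfun F F' B (v x))"
    and M_continuous: "continuous_on (closure \<Omega>) (\<lambda>x. M (v x))"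
    and M_nonneg: "\<And>x. x \<in> closure \<Omega> \<Longrightarrow> 0 \<le> M (v x)"
    and v: "v \<in> V" and Y: "Y \<in> C0 \<Omega>"
begin

definition H :: "real^'d \<Rightarrow> real" where "H x = Hfun F F' B (v x)"

definition P :: "real^'d \<Rightarrow> real" where "P = L2_proj \<Omega> V Y"

text \<open>
  The solution \<open>U\<close> of the pointwise equation for given \<open>u\<close>, with value zero outside \<open>closure \<Omega>\<close> as in \<open>C0 \<Omega>\<close>.
\<close>

definition auxiliary :: "(real^'d \<Rightarrow> real) \<Rightarrow> real^'d \<Rightarrow> real" where
  "auxiliary u x = (if x \<in> closure \<Omega> then P x + 1/2 * H x * (u x - v x) else 0)"

definition mobility_form :: "(real^'d \<Rightarrow> real) \<Rightarrow> (real^'d \<Rightarrow> real) \<Rightarrow> real" where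
  "mobility_form = A_form \<Omega> (\<lambda>x. M (v x))"

text \<open>
  The second summand is half of \<open>(H u, H \<psi>)\<close>; it comes from the part of the new auxiliary variable that
  depends on the new phase field.
\<close>

definition stiffness_form :: "(real^'d \<Rightarrow> real) \<Rightarrow> (real^'d \<Rightarrow> real) \<Rightarrow> real" where
  "stiffness_form u \<psi> = A_form \<Omega> (\<lambda>x. \<epsilon>\<^sup>2) u \<psi> + 1/2 * L2_inner \<Omega> (\<lambda>x. (H x)\<^sup>2 * u x) \<psi>"

text \<open>
  The part of \<open>H * auxiliary u\<close> that does not depend on \<open>u\<close>.
\<close>

definition load :: "real^'d \<Rightarrow> real" where
  "load x = H x * P x - 1/2 * ((H x)\<^sup>2 * v x)"

lemma H_cont: "continuous_on (closure \<Omega>) H"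
  unfolding H_def using H_continuous .

lemma P_V: "P \<in> V"
  unfolding P_def by (rule L2_proj(1)[OF C0_L2[OF Y]])

lemma V_continuous: "u \<in> V \<Longrightarrow> continuous_on (closure \<Omega>) u"
  using V_C0 unfolding C0_def by blast

lemma in_L2: "u \<in> V \<Longrightarrow> u \<in> L2 \<Omega>"
  using V_L2 by blast

lemma auxiliary_C0: "u \<in> V \<Longrightarrow> auxiliary u \<in> C0 \<Omega>"
proof -
  assume u: "u \<in> V"
  have "continuous_on (closure \<Omega>) (\<lambda>x. P x + 1/2 * H x * (u x - v x))"
    by (intro continuous_on_add continuous_on_mult continuous_on_diff continuous_on_const
        H_cont V_continuous u v P_V)
  then have "continuous_on (closure \<Omega>) (auxiliary u)"
    by (rule continuous_on_eq) (simp add: auxiliary_def)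
  then show ?thesis unfolding C0_def by (simp add: auxiliary_def)
qed

lemma mobility_psd: "psd_form_on V mobility_form"
  unfolding mobility_form_def
  by (rule psd_form_on_A_form[OF \<Omega> V_H1 M_continuous]) (use M_nonneg closure_subset in blast)

lemma stiffness_psd: "psd_form_on V stiffness_form"
proof -
  have "psd_form_on V (A_form \<Omega> (\<lambda>x. \<epsilon>\<^sup>2))"
    by (rule psd_form_on_A_form[OF \<Omega> V_H1 continuous_on_const]) simp
  moreover have "psd_form_on V (\<lambda>u \<psi>. L2_inner \<Omega> (\<lambda>x. (H x)\<^sup>2 * u x) \<psi>)"
    by (rule psd_form_on_weighted_L2[OF \<Omega> V_L2 continuous_on_power[OF H_cont]]) simp
  ultimately show ?thesis
    unfolding stiffness_form_def[abs_def] by (rule psd_form_on_combination) simp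
qed

lemma load_L2: "load \<in> L2 \<Omega>"
  by (rule continuous_on_closure_in_L2[OF \<Omega>])
     (unfold load_def[abs_def], intro continuous_on_mult continuous_on_diff continuous_on_power continuous_on_const
        H_cont V_continuous v P_V)

text \<open>
  Substitutes the solved pointwise equation into the chemical potential equation and sorts the result
  into a part linear in \<open>u\<close> and a known load.
\<close>

lemma stiffness_load_eq:
  assumes u: "u \<in> V" and \<psi>: "\<psi> \<in> V"
  shows "stiffness_form u \<psi> + L2_inner \<Omega> load \<psi>
       = A_form \<Omega> (\<lambda>x. \<epsilon>\<^sup>2) u \<psi> + L2_inner \<Omega> (\<lambda>x. H x * auxiliary u x) \<psi>"
proof -
  have HH: "(\<lambda>x. (H x)\<^sup>2 * u x) \<in> L2 \<Omega>"
    by (rule L2_continuous_mult[OF \<Omega> continuous_on_power[OF H_cont] in_L2[OF u]])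
  have "L2_inner \<Omega> (\<lambda>x. H x * auxiliary u x) \<psi>
      = integ \<Omega> (\<lambda>x. 1/2 * ((H x)\<^sup>2 * u x * \<psi> x) + load x * \<psi> x)"
    unfolding L2_inner_def integ_def
  proof (rule Bochner_Integration.integral_cong[OF refl])
    fix x assume "x \<in> space (lebesgue_on \<Omega>)"
    then have "x \<in> closure \<Omega>" using closure_subset[of \<Omega>] by auto
    then show "H x * auxiliary u x * \<psi> x = 1/2 * ((H x)\<^sup>2 * u x * \<psi> x) + load x * \<psi> x"
      by (simp add: auxiliary_def load_def power2_eq_square algebra_simps add_divide_distrib diff_divide_distrib)
  qed
  also have "\<dots> = 1/2 * L2_inner \<Omega> (\<lambda>x. (H x)\<^sup>2 * u x) \<psi> + L2_inner \<Omega> load \<psi>"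
    unfolding L2_inner_def integ_def
    using L2_mult_integrable[OF HH in_L2[OF \<psi>]] L2_mult_integrable[OF load_L2 in_L2[OF \<psi>]] by simp
  finally show ?thesis unfolding stiffness_form_def by simp
qed

lemma difference_quotient_eq:
  assumes u: "u \<in> V" and \<phi>: "\<phi> \<in> V"
  shows "L2_inner \<Omega> (\<lambda>x. (u x - v x) / dt) \<phi> = (L2_inner \<Omega> u \<phi> - L2_inner \<Omega> v \<phi>) / dt"
proof -
  have "L2_inner \<Omega> (\<lambda>x. (u x - v x) / dt) \<phi> = L2_inner \<Omega> (\<lambda>x. u x - v x) \<phi> / dt"
    unfolding L2_inner_def integ_def by simp
  then show ?thesis using L2_inner_diff_left[OF in_L2[OF u] in_L2[OF v] in_L2[OF \<phi>]] by simp
qed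

text \<open>
  Elimination of the auxiliary variable: a step is a solution of the coupled linear system.
\<close>

lemma scheme_step_iff:
  "scheme_step \<Omega> V \<epsilon> F F' B M dt v Y u w U \<longleftrightarrow>
     u \<in> V \<and> w \<in> V \<and> U = auxiliary u \<and>
     (\<forall>\<phi>\<in>V. L2_inner \<Omega> u \<phi> + dt * mobility_form w \<phi> = L2_inner \<Omega> v \<phi>) \<and>
     (\<forall>\<psi>\<in>V. L2_inner \<Omega> w \<psi> = stiffness_form u \<psi> + L2_inner \<Omega> load \<psi>)"
proof (cases "u \<in> V \<and> w \<in> V")
  case uw: True
  have U: "U \<in> C0 \<Omega> \<and> (\<forall>x\<in>closure \<Omega>. (U x - L2_proj \<Omega> V Y x) / dt = 1/2 * Hfun F F' B (v x) * ((u x - v x) / dt))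
      \<longleftrightarrow> U = auxiliary u"
  proof
    assume L: "U \<in> C0 \<Omega> \<and> (\<forall>x\<in>closure \<Omega>. (U x - L2_proj \<Omega> V Y x) / dt = 1/2 * Hfun F F' B (v x) * ((u x - v x) / dt))"
    show "U = auxiliary u"
    proof
      fix x
      show "U x = auxiliary u x"
      proof (cases "x \<in> closure \<Omega>")
        case True
        then have "(U x - P x) / dt = 1/2 * H x * ((u x - v x) / dt)"
          using L unfolding P_def H_def by blast
        then have "(U x - P x) / dt = (1/2 * H x * (u x - v x)) / dt" by simp
        then have "U x - P x = 1/2 * H x * (u x - v x)" using dt unfolding divide_cancel_right by simp
        then show ?thesis using True by (simp add: auxiliary_def)
      next
        case False
        then show ?thesis using L by (simp add: C0_def auxiliary_def)
      qed
    qed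
  next
    assume "U = auxiliary u"
    then show "U \<in> C0 \<Omega> \<and> (\<forall>x\<in>closure \<Omega>. (U x - L2_proj \<Omega> V Y x) / dt = 1/2 * Hfun F F' B (v x) * ((u x - v x) / dt))"
      using auxiliary_C0 uw by (simp add: auxiliary_def P_def H_def)
  qed
  have 1: "L2_inner \<Omega> (\<lambda>x. (u x - v x) / dt) \<phi> = - A_form \<Omega> (\<lambda>x. M (v x)) w \<phi> \<longleftrightarrow>
      L2_inner \<Omega> u \<phi> + dt * mobility_form w \<phi> = L2_inner \<Omega> v \<phi>" if "\<phi> \<in> V" for \<phi>
  proof -
    have "(a - b) / dt = - c \<longleftrightarrow> a + dt * c = b" for a b c
      using dt by (auto simp: divide_eq_eq mult.commute)
    then show ?thesis using difference_quotient_eq[of u \<phi>] uw that unfolding mobility_form_def by simp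
  qed
  have 2: "L2_inner \<Omega> w \<psi> = A_form \<Omega> (\<lambda>x. \<epsilon>\<^sup>2) u \<psi> + L2_inner \<Omega> (\<lambda>x. Hfun F F' B (v x) * U x) \<psi> \<longleftrightarrow>
      L2_inner \<Omega> w \<psi> = stiffness_form u \<psi> + L2_inner \<Omega> load \<psi>" if "\<psi> \<in> V" "U = auxiliary u" for \<psi>
    using stiffness_load_eq[of u \<psi>] uw that unfolding H_def by simp
  show ?thesis
    unfolding scheme_step_def using U 1 2 uw by meson
next
  case False
  then show ?thesis unfolding scheme_step_def by blast
qed

proposition unique_solution:
  "\<exists>!s. case s of (u, w, U) \<Rightarrow> scheme_step \<Omega> V \<epsilon> F F' B M dt v Y u w U"
proof -
  obtain G where G: "finite G" "V \<subseteq> span G" using fin_dim by blast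
  have lin: "linear_form_on V (L2_inner \<Omega> v)" "linear_form_on V (L2_inner \<Omega> load)"
    by (rule linear_form_on_L2_inner[OF _ V_L2], rule in_L2[OF v])
       (rule linear_form_on_L2_inner[OF load_L2 V_L2])
  have m: "psd_form_on V (\<lambda>w \<phi>. dt * mobility_form w \<phi>)"
  proof -
    have "psd_form_on V (\<lambda>_ _. 0)" by (rule psd_form_onI) (simp_all add: linear_form_on_def)
    from psd_form_on_combination[OF this mobility_psd, of dt] show ?thesis using dt by simp
  qed
  obtain u w where uw: "u \<in> V" "w \<in> V"
    "\<And>\<phi>. \<phi> \<in> V \<Longrightarrow> L2_inner \<Omega> u \<phi> + dt * mobility_form w \<phi> = L2_inner \<Omega> v \<phi>"
    "\<And>\<psi>. \<psi> \<in> V \<Longrightarrow> L2_inner \<Omega> w \<psi> = stiffness_form u \<psi> + L2_inner \<Omega> load \<psi>"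
    by (rule coupled_system_solvable[OF subspace_V G inner_product_on_V m stiffness_psd lin]) blast
  show ?thesis
  proof (rule ex1I[of _ "(u, w, auxiliary u)"])
    show "case (u, w, auxiliary u) of (u, w, U) \<Rightarrow> scheme_step \<Omega> V \<epsilon> F F' B M dt v Y u w U"
      using uw by (simp add: scheme_step_iff)
    fix s assume s: "case s of (u, w, U) \<Rightarrow> scheme_step \<Omega> V \<epsilon> F F' B M dt v Y u w U"
    obtain u' w' U' where s_eq: "s = (u', w', U')" by (cases s)
    have uw': "u' \<in> V" "w' \<in> V" "U' = auxiliary u'"
      "\<And>\<phi>. \<phi> \<in> V \<Longrightarrow> L2_inner \<Omega> u' \<phi> + dt * mobility_form w' \<phi> = L2_inner \<Omega> v \<phi>"
      "\<And>\<psi>. \<psi> \<in> V \<Longrightarrow> L2_inner \<Omega> w' \<psi> = stiffness_form u' \<psi> + L2_inner \<Omega> load \<psi>"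
      using s unfolding s_eq by (simp_all add: scheme_step_iff)
    have "u' = u \<and> w' = w"
      by (rule coupled_system_unique[OF subspace_V inner_product_on_V m stiffness_psd uw'(1,2) uw(1,2),
            where f = "L2_inner \<Omega> v" and g = "L2_inner \<Omega> load"])
         (simp_all add: uw uw')
    then show "s = (u, w, auxiliary u)" using s_eq uw'(3) by simp
  qed
qed

lemma L2_inner_constant: "L2_inner \<Omega> f (indicat_real (closure \<Omega>)) = integ \<Omega> f"
  unfolding L2_inner_def integ_def
proof (rule Bochner_Integration.integral_cong[OF refl])
  fix x assume "x \<in> space (lebesgue_on \<Omega>)"
  then have "x \<in> closure \<Omega>" using closure_subset[of \<Omega>] by auto
  then show "f x * indicat_real (closure \<Omega>) x = f x" by simp
qed

text \<open>
  Test the first equation with the constant one.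
\<close>

proposition mass_conservation:
  assumes "scheme_step \<Omega> V \<epsilon> F F' B M dt v Y u w U"
  shows "integ \<Omega> u = integ \<Omega> v"
proof -
  have w: "w \<in> H1 \<Omega>" and eq: "\<forall>\<phi>\<in>V. L2_inner \<Omega> u \<phi> + dt * mobility_form w \<phi> = L2_inner \<Omega> v \<phi>"
    using assms V_H1 unfolding scheme_step_iff by blast+
  have "mobility_form w (indicat_real (closure \<Omega>)) = 0"
    unfolding mobility_form_def by (rule A_form_constant[OF \<Omega> M_continuous w])
  then show ?thesis using bspec[OF eq const_V] by (simp add: L2_inner_constant)
qed

text \<open>
  The potential terms match because \<open>H (u - v) = 2 (U - P)\<close> on \<open>closure \<Omega>\<close>, so that
  \<open>(H U, u - v) = 2 (U, U - P)\<close>: the chain rule for the square root of the potential, discretised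
  without remainder.
\<close>

proposition energy_identity:
  assumes step: "scheme_step \<Omega> V \<epsilon> F F' B M dt v Y u w U"
  shows "energy \<Omega> \<epsilon> B u U = energy \<Omega> \<epsilon> B v (L2_proj \<Omega> V Y)
     - (L2_norm \<Omega> (\<lambda>x. U x - L2_proj \<Omega> V Y x))\<^sup>2
     - dt * A_form \<Omega> (\<lambda>x. M (v x)) w w
     - 1/2 * A_form \<Omega> (\<lambda>x. \<epsilon>\<^sup>2) (\<lambda>x. u x - v x) (\<lambda>x. u x - v x)"
proof -
  let ?A = "A_form \<Omega> (\<lambda>x. \<epsilon>\<^sup>2)"
  have u: "u \<in> V" and w: "w \<in> V" and U: "U = auxiliary u"
    and eq1: "\<And>\<phi>. \<phi> \<in> V \<Longrightarrow> L2_inner \<Omega> u \<phi> + dt * mobility_form w \<phi> = L2_inner \<Omega> v \<phi>"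
    and eq2: "\<And>\<psi>. \<psi> \<in> V \<Longrightarrow> L2_inner \<Omega> w \<psi> = stiffness_form u \<psi> + L2_inner \<Omega> load \<psi>"
    using step unfolding scheme_step_iff by blast+
  define D where "D = u - v"
  have D: "D \<in> V" unfolding D_def by (rule subspace_diff[OF subspace_V u v])
  have UL: "U \<in> L2 \<Omega>" using C0_L2[OF auxiliary_C0[OF u]] U by simp
  have PL: "P \<in> L2 \<Omega>" by (rule in_L2[OF P_V])
  define E where "E x = U x - P x" for x
  have EL: "E \<in> L2 \<Omega>"
    using L2_add[OF UL L2_scale[OF PL, of "-1"]] by (simp add: E_def[abs_def])
  have "psd_form_on V ?A"
    by (rule psd_form_on_A_form[OF \<Omega> V_H1 continuous_on_const]) simp
  note bil = psd_form_onD(1)[OF this]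
  \<comment> \<open>\<open>(a\<^sup>2 - b\<^sup>2) / 2 = a (a - b) - (a - b)\<^sup>2 / 2\<close> for the gradients.\<close>
  have bending: "1/2 * ?A u u - 1/2 * ?A v v = ?A u D - 1/2 * ?A D D"
    unfolding D_def
    using u v by (simp add: bilinear_form_on_left[OF bil subspace_V] bilinear_form_on_right[OF bil subspace_V]
        subspace_diff[OF subspace_V] A_form_sym[of \<Omega> _ v u] add_divide_distrib diff_divide_distrib)
  \<comment> \<open>The first equation tested with \<open>\<phi> = w\<close>.\<close>
  have dissipation: "L2_inner \<Omega> w D = - dt * mobility_form w w"
  proof -
    have "L2_inner \<Omega> D w = L2_inner \<Omega> u w - L2_inner \<Omega> v w"
      using L2_inner_diff_left[OF in_L2[OF u] in_L2[OF v] in_L2[OF w]] unfolding D_def fun_diff_def .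
    then show ?thesis using eq1[OF w] by (simp add: L2_inner_sym[of \<Omega> w D])
  qed
  \<comment> \<open>The second equation tested with \<open>\<psi> = u - v\<close>.\<close>
  have "L2_inner \<Omega> w D = ?A u D + L2_inner \<Omega> (\<lambda>x. H x * U x) D"
    unfolding U using eq2[OF D] stiffness_load_eq[OF u D] by simp
  moreover have "L2_inner \<Omega> (\<lambda>x. H x * U x) D = 2 * L2_inner \<Omega> U E"
  proof -
    have "L2_inner \<Omega> (\<lambda>x. H x * U x) D = integ \<Omega> (\<lambda>x. 2 * (U x * E x))"
      unfolding L2_inner_def integ_def
    proof (rule Bochner_Integration.integral_cong[OF refl])
      fix x assume "x \<in> space (lebesgue_on \<Omega>)"
      then have "x \<in> closure \<Omega>" using closure_subset[of \<Omega>] by auto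
      then have "E x = 1/2 * (H x * D x)" unfolding E_def U by (simp add: auxiliary_def D_def)
      then show "H x * U x * D x = 2 * (U x * E x)" by simp
    qed
    then show ?thesis unfolding L2_inner_def integ_def by simp
  qed
  moreover have "2 * L2_inner \<Omega> U E = integ \<Omega> (\<lambda>x. (U x)\<^sup>2) - integ \<Omega> (\<lambda>x. (P x)\<^sup>2) + L2_inner \<Omega> E E"
  proof -
    have "(\<lambda>x. (U x)\<^sup>2) = (\<lambda>x. 2 * (U x * E x) + (P x * P x) - E x * E x)"
      by (rule ext) (simp add: E_def power2_eq_square algebra_simps)
    then have "integ \<Omega> (\<lambda>x. (U x)\<^sup>2) = integ \<Omega> (\<lambda>x. 2 * (U x * E x) + (P x * P x) - E x * E x)"
      by (rule arg_cong)
    also have "\<dots> = 2 * L2_inner \<Omega> U E + integ \<Omega> (\<lambda>x. (P x)\<^sup>2) - L2_inner \<Omega> E E"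
      unfolding L2_inner_def integ_def power2_eq_square
      using L2_mult_integrable[OF UL EL] L2_mult_integrable[OF PL PL] L2_mult_integrable[OF EL EL] by simp
    finally show ?thesis by simp
  qed
  moreover have "(L2_norm \<Omega> E)\<^sup>2 = L2_inner \<Omega> E E"
  proof -
    have "0 \<le> L2_inner \<Omega> E E" unfolding L2_inner_def integ_def by (rule integral_nonneg_AE) simp
    then show ?thesis unfolding L2_norm_def by simp
  qed
  ultimately have "energy \<Omega> \<epsilon> B u U = energy \<Omega> \<epsilon> B v P - (L2_norm \<Omega> E)\<^sup>2
      - dt * mobility_form w w - 1/2 * ?A D D"
    using bending dissipation unfolding energy_def by linarith
  then show ?thesis
    unfolding E_def[abs_def] D_def P_def mobility_form_def fun_diff_def .
qed

end

section \<open>The scheme on a triangulated domain\<close>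

lemma galerkin_space_Vh:
  assumes domain: "bounded_domain \<Omega>" and mesh: "triangulates \<T> \<Omega>"
  shows "galerkin_space \<Omega> (Vh k \<T> \<Omega>)"
proof
  show \<Omega>: "open \<Omega>" "bounded \<Omega>" using domain unfolding bounded_domain_def by auto
  have \<T>: "finite \<T>" "\<Union>\<T> = closure \<Omega>" using mesh unfolding triangulates_def triangulation_def by auto
  show "subspace (Vh k \<T> \<Omega>)" by (rule Vh_subspace[OF \<Omega> \<T>(2)])
  show "\<exists>G. finite G \<and> Vh k \<T> \<Omega> \<subseteq> span G" by (rule Vh_finite_dim[OF \<T>])
  show "Vh k \<T> \<Omega> \<subseteq> C0 \<Omega>" "Vh k \<T> \<Omega> \<subseteq> H1 \<Omega>" using VhD by blast+
  show "indicat_real (closure \<Omega>) \<in> Vh k \<T> \<Omega>" by (rule constant_in_Vh[OF \<Omega> \<T>(2)])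
qed

lemma continuous_on_Hfun_comp:
  assumes F: "\<And>s. s \<in> I \<Longrightarrow> (F has_real_derivative F' s) (at s within I)" "continuous_on I F'"
    and v: "continuous_on S v" "\<And>x. x \<in> S \<Longrightarrow> v x \<in> I \<and> 0 < F (v x) + B"
  shows "continuous_on S (\<lambda>x. Hfun F F' B (v x))"
proof -
  have img: "v ` S \<subseteq> I" using v(2) by blast
  have "continuous_on I F" using F(1) by (rule DERIV_continuous_on)
  then have "continuous_on S (\<lambda>x. F (v x))" "continuous_on S (\<lambda>x. F' (v x))"
    using continuous_on_compose2[OF _ v(1) img] F(2) by blast+
  moreover have "\<forall>x\<in>S. sqrt (F (v x) + B) \<noteq> 0" using v(2) by fastforce
  ultimately show ?thesis
    unfolding Hfun_def by (intro continuous_on_divide continuous_on_real_sqrt continuous_on_add continuous_on_const) auto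
qed

theorem theorem2p2:
  fixes \<Omega> :: "(real^'d::finite) set" and \<T> :: "(real^'d) set set"
    and \<sigma> \<epsilon> B dt :: real and k :: nat
    and F F' M :: "real \<Rightarrow> real" and I J :: "real set"
    and u0 :: "real^'d \<Rightarrow> real"
  defines "V \<equiv> Vh k \<T> \<Omega>"
  defines "U0 \<equiv> (\<lambda>x. if x \<in> closure \<Omega> then sqrt (F (u0 x) + B) else 0)"
  assumes dim: "CARD('d) \<in> {2, 3}"
    and domain: "bounded_domain \<Omega>"
    and mesh: "triangulates \<T> \<Omega>" "quasi_uniform \<sigma> \<T>"
    and k: "1 \<le> k"
    and eps: "0 < \<epsilon>"
    and dt: "0 < dt"
    and B: "0 \<le> B"
    and I: "is_interval I"
    and F_C1: "\<And>s. s \<in> I \<Longrightarrow> (F has_real_derivative F' s) (at s within I)" "continuous_on I F'"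
    and M: "continuous_on J M" "\<And>s. s \<in> J \<Longrightarrow> 0 \<le> M s"
    and u0_L2: "u0 \<in> L2 \<Omega>"
    and u0_values: "\<And>x. x \<in> closure \<Omega> \<Longrightarrow> u0 x \<in> I \<and> 0 < F (u0 x) + B"
    and U0_C0: "U0 \<in> C0 \<Omega>"
  shows "(\<forall>v\<in>V. \<forall>Y\<in>C0 \<Omega>.
           (\<forall>x\<in>closure \<Omega>. v x \<in> I \<and> v x \<in> J \<and> 0 < F (v x) + B) \<longrightarrow>
           (\<exists>!s. case s of (u', w', U') \<Rightarrow>
              scheme_step \<Omega> V \<epsilon> F F' B M dt v Y u' w' U')) \<and>
         (\<forall>N u w U.
           u 0 = L2_proj \<Omega> V u0 \<and> U 0 = U0 \<and>
           (\<forall>n<N. (\<forall>x\<in>closure \<Omega>. u n x \<in> I \<and> u n x \<in> J \<and> 0 < F (u n x) + B) \<and>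
              scheme_step \<Omega> V \<epsilon> F F' B M dt (u n) (U n) (u (Suc n)) (w (Suc n)) (U (Suc n))) \<longrightarrow>
           u 0 \<in> V \<and>
           (\<forall>n\<le>N. integ \<Omega> (u n) = integ \<Omega> (u 0)) \<and>
           (\<forall>n<N.
              energy \<Omega> \<epsilon> B (u (Suc n)) (L2_proj \<Omega> V (U (Suc n)))
                \<le> energy \<Omega> \<epsilon> B (u (Suc n)) (U (Suc n)) \<and>
              energy \<Omega> \<epsilon> B (u (Suc n)) (U (Suc n))
                = energy \<Omega> \<epsilon> B (u n) (L2_proj \<Omega> V (U n))
                  - (L2_norm \<Omega> (\<lambda>x. U (Suc n) x - L2_proj \<Omega> V (U n) x))\<^sup>2
                  - dt * A_form \<Omega> (\<lambda>x. M (u n x)) (w (Suc n)) (w (Suc n))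
                  - 1/2 * A_form \<Omega> (\<lambda>x. \<epsilon>\<^sup>2)
                      (\<lambda>x. u (Suc n) x - u n x) (\<lambda>x. u (Suc n) x - u n x)))"
proof -
  interpret galerkin_space \<Omega> V unfolding V_def by (rule galerkin_space_Vh[OF domain mesh(1)])
  have step_data: "scheme_data \<Omega> V B dt F F' M v Y"
    if vY: "v \<in> V" "Y \<in> C0 \<Omega>" and in_range: "\<And>x. x \<in> closure \<Omega> \<Longrightarrow> v x \<in> I \<and> v x \<in> J \<and> 0 < F (v x) + B" for v Y
  proof unfold_locales
    have cont: "continuous_on (closure \<Omega>) v" using vY(1) V_C0 unfolding C0_def by blast
    show "continuous_on (closure \<Omega>) (\<lambda>x. Hfun F F' B (v x))"
      by (rule continuous_on_Hfun_comp[OF F_C1 cont]) (use in_range in blast)+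
    show "continuous_on (closure \<Omega>) (\<lambda>x. M (v x))"
      by (rule continuous_on_compose2[OF M(1) cont]) (use in_range in blast)
    show "0 \<le> M (v x)" if "x \<in> closure \<Omega>" for x using M(2) in_range[OF that] by blast
  qed (use dt vY in auto)
  show ?thesis
  proof (intro conjI allI impI ballI)
    fix v Y assume "v \<in> V" "Y \<in> C0 \<Omega>" "\<forall>x\<in>closure \<Omega>. v x \<in> I \<and> v x \<in> J \<and> 0 < F (v x) + B"
    then interpret scheme_data \<Omega> V \<epsilon> B dt F F' M v Y by (intro step_data) auto
    show "\<exists>!s. case s of (u', w', U') \<Rightarrow> scheme_step \<Omega> V \<epsilon> F F' B M dt v Y u' w' U'"
      by (rule unique_solution)
  next
    \<comment> \<open>Iterates stay in the right spaces, so each step of the run is an instance of the one-step results.\<close>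
    fix N u w U
    assume run: "u 0 = L2_proj \<Omega> V u0 \<and> U 0 = U0 \<and>
           (\<forall>n<N. (\<forall>x\<in>closure \<Omega>. u n x \<in> I \<and> u n x \<in> J \<and> 0 < F (u n x) + B) \<and>
              scheme_step \<Omega> V \<epsilon> F F' B M dt (u n) (U n) (u (Suc n)) (w (Suc n)) (U (Suc n)))"
    then have step: "scheme_step \<Omega> V \<epsilon> F F' B M dt (u n) (U n) (u (Suc n)) (w (Suc n)) (U (Suc n))"
      if "n < N" for n using that by blast
    show u0_V: "u 0 \<in> V" using L2_proj(1)[OF u0_L2] run by simp
    have uU: "u n \<in> V \<and> U n \<in> C0 \<Omega>" if "n \<le> N" for n
    proof (cases n)
      case 0
      then show ?thesis using u0_V run U0_C0 by simp
    next
      case (Suc m)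
      then show ?thesis using step[of m] that unfolding scheme_step_def by simp
    qed
    have data: "scheme_data \<Omega> V B dt F F' M (u n) (U n)" if "n < N" for n
      by (rule step_data) (use uU[of n] run that in auto)
    show "integ \<Omega> (u n) = integ \<Omega> (u 0)" if "n \<le> N" for n
      using that
    proof (induction n)
      case (Suc n)
      then interpret scheme_data \<Omega> V \<epsilon> B dt F F' M "u n" "U n" by (intro data) simp
      show ?case using mass_conservation[OF step[of n]] Suc by simp
    qed simp
    fix n assume n: "n < N"
    interpret step: scheme_data \<Omega> V \<epsilon> B dt F F' M "u n" "U n" by (rule data[OF n])
    show "energy \<Omega> \<epsilon> B (u (Suc n)) (L2_proj \<Omega> V (U (Suc n))) \<le> energy \<Omega> \<epsilon> B (u (Suc n)) (U (Suc n))"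
      by (rule energy_proj_le) (use uU[of "Suc n"] n in simp)
    show "energy \<Omega> \<epsilon> B (u (Suc n)) (U (Suc n))
                = energy \<Omega> \<epsilon> B (u n) (L2_proj \<Omega> V (U n))
                  - (L2_norm \<Omega> (\<lambda>x. U (Suc n) x - L2_proj \<Omega> V (U n) x))\<^sup>2
                  - dt * A_form \<Omega> (\<lambda>x. M (u n x)) (w (Suc n)) (w (Suc n))
                  - 1/2 * A_form \<Omega> (\<lambda>x. \<epsilon>\<^sup>2)
                      (\<lambda>x. u (Suc n) x - u n x) (\<lambda>x. u (Suc n) x - u n x)"
      by (rule step.energy_identity[OF step[OF n]])
  qed
qed

end
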